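(* Let $0\le\lambda<\infty$, $0<p<\infty$, $\vec q=(q_1,\dots,q_n)$ with $1<q_i<\infty$ for all $i$, and $$-\sum_{i=1}^n\frac1{q_i}+\lambda<\alpha<n\Big(1-\frac1n\sum_{i=1}^n\frac1{q_i}\Big).$$ Suppose a sublinear operator $T$ satisfies: (1) $T$ is bounded on $L^{\vec q}(\mathbb R^n)$; (2) there is a constant $C$ such that for every $k\in\mathbb Z$ and every $f\in L^1(\mathbb R^n)$ with $\operatorname{supp} f\subseteq A_k$, $|Tf(x)|\le C\,\|f\|_{L^1}\,|x|^{-n}$ whenever $|x|\ge 2^{k+1}$; (3) there is a constant $C$ such that for every $k\in\mathbb Z$ and every $f\in L^1(\mathbb R^n)$ with $\operatorname{supp} f\subseteq A_k$, $|Tf(x)|\le C\,\|f\|_{L^1}\,2^{-nk}$ whenever $|x|\le 2^{k-2}$. Then $T$ is bounded on $M\dot K^{\alpha,\lambda}_{p,\vec q}(\mathbb R^n)$, i.e. there is a constant $C$ with $\|Tf\|_{M\dot K^{\alpha,\lambda}_{p,\vec q}}\le C\|f\|_{M\dot K^{\alpha,\lambda}_{p,\vec q}}$ for all $f\in M\dot K^{\alpha,\lambda}_{p,\vec q}(\mathbb R^n)$.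
   Context: For $k\in\mathbb Z$: $B_k=\{x\in\mathbb R^n:|x|\le 2^k\}$, $A_k=B_k\setminus B_{k-1}$, $\chi_k=\chi_{A_k}$ (characteristic function). "$\operatorname{supp} f\subseteq A_k$" means $f$ vanishes a.e. outside $A_k$. Mixed Lebesgue space: for $\vec q=(q_1,\dots,q_n)\in(0,\infty)^n$, $L^{\vec q}(\mathbb R^n)$ is the set of measurable $f$ with $$\|f\|_{L^{\vec q}}=\Big(\int_{\mathbb R}\cdots\Big(\int_{\mathbb R}\Big(\int_{\mathbb R}|f(x_1,\dots,x_n)|^{q_1}dx_1\Big)^{q_2/q_1}dx_2\Big)^{q_3/q_2}\cdots dx_n\Big)^{1/q_n}<\infty.$$ Homogeneous mixed Herz-Morrey space: for $\alpha\in\mathbb R$, $0<p<\infty$, $0\le\lambda<\infty$, $\vec q\in[1,\infty)^n$, $M\dot K^{\alpha,\lambda}_{p,\vec q}(\mathbb R^n)$ is the set of $f\in L^{\vec q}_{loc}(\mathbb R^n\setminus\{0\})$ with $$\|f\|_{M\dot K^{\alpha,\lambda}_{p,\vec q}}=\sup_{k_0\in\mathbb Z}2^{-k_0\lambda}\Big\{\sum_{k=-\infty}^{k_0}2^{k\alpha p}\|f\chi_k\|_{L^{\vec q}}^p\Big\}^{1/p}<\infty.$$ A sublinear operator $T$ maps functions on $\mathbb R^n$ to measurable functions and satisfies $|T(f+g)|\le|Tf|+|Tg|$ and $|T(cf)|=|c||Tf|$ for scalars $c$; its domain is understood to contain all the functions to which it is applied.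
   Formalization: It is additionally assumed that |Tf| ≤ Σ_k |T(fχ_k)| a.e. for every f in the Herz-Morrey space not in L^q; with finite subadditivity alone the claim fails, e.g. for Tg = Λ(g)·1 with a linear functional Λ vanishing on L^q and on all L^1 functions supported in an annulus. *)

theory Defs
  imports "HOL-Analysis.Analysis"
begin

text \<open>
  Points of R^n are vectors of type \<open>real^'n\<close>, where the finite linear order
  \<open>'n\<close> plays the role of 1 < 2 < ... < n; the order matters because mixed
  Lebesgue norms depend on the order of integration.  Scalars are of a type in the sort
  \<open>{real_normed_field, euclidean_space}\<close>, which covers both the real and the
  complex numbers.  "Measurable" and "almost everywhere" refer to Lebesgue measure.
\<close>

definition dyadic_ball :: "int \<Rightarrow> (real^'n) set" where
  "dyadic_ball k = {x. norm x \<le> 2 powi k}"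

definition annulus :: "int \<Rightarrow> (real^'n) set" where
  "annulus k = dyadic_ball k - dyadic_ball (k - 1)"

definition restr :: "'x set \<Rightarrow> ('x \<Rightarrow> 'a::real_vector) \<Rightarrow> 'x \<Rightarrow> 'a" where
  "restr S f = (\<lambda>x. indicator S x *\<^sub>R f x)"

definition L1_on_annulus :: "int \<Rightarrow> (real^'n \<Rightarrow> 'a::euclidean_space) set" where
  "L1_on_annulus k =
     {f. integrable lebesgue f \<and> (AE x in lebesgue. x \<notin> annulus k \<longrightarrow> f x = 0)}"

text \<open>Powers of extended nonnegative reals; used for exponents a > 0 only.\<close>

definition ennreal_powr :: "ennreal \<Rightarrow> real \<Rightarrow> ennreal" where
  "ennreal_powr t a = (if t = \<infinity> then \<infinity> else ennreal (enn2real t powr a))"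

text \<open>
  The list contains the coordinates still to be integrated, innermost first, and
  \<open>r\<close> is the exponent of the coordinate integrated last (1 at the start).
  Thus \<open>mixed_iter q 1 [1, ..., n] F\<close> integrates \<open>F powr q$1\<close> over the first
  coordinate, the result raised to the power \<open>q$2 / q$1\<close> over the second one, and so on,
  and finally takes the power \<open>1 / q$n\<close>.  When all coordinates have been
  integrated the value no longer depends on the point; \<open>mixed_norm\<close> takes it at 0.
\<close>

primrec mixed_iter ::
    "real^'n \<Rightarrow> real \<Rightarrow> 'n list \<Rightarrow> (real^'n \<Rightarrow> ennreal) \<Rightarrow> real^'n \<Rightarrow> ennreal" where
  "mixed_iter q r [] F = (\<lambda>x. ennreal_powr (F x) (1 / r))"
| "mixed_iter q r (i # is) F =
     mixed_iter q (q $ i) is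
       (\<lambda>x. \<integral>\<^sup>+ t. ennreal_powr (F (\<chi> j. if j = i then t else x $ j)) (q $ i / r) \<partial>lebesgue)"

definition mixed_norm ::
    "real^'n::{finite,linorder} \<Rightarrow> (real^'n::{finite,linorder} \<Rightarrow> 'a::real_normed_vector) \<Rightarrow> ennreal" where
  "mixed_norm q f =
     mixed_iter q 1 (sorted_list_of_set UNIV) (\<lambda>x. ennreal (norm (f x))) 0"

definition mixed_Lebesgue ::
    "real^'n::{finite,linorder} \<Rightarrow> (real^'n::{finite,linorder} \<Rightarrow> 'a::real_normed_vector) set" where
  "mixed_Lebesgue q = {f. f \<in> borel_measurable lebesgue \<and> mixed_norm q f < \<infinity>}"

definition mixed_Lebesgue_loc ::
    "real^'n::{finite,linorder} \<Rightarrow> (real^'n::{finite,linorder} \<Rightarrow> 'a::real_normed_vector) set" where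
  "mixed_Lebesgue_loc q =
     {f. f \<in> borel_measurable lebesgue \<and>
         (\<forall>K. compact K \<and> K \<subseteq> UNIV - {0} \<longrightarrow> restr K f \<in> mixed_Lebesgue q)}"

definition herz_morrey_norm ::
    "real \<Rightarrow> real \<Rightarrow> real \<Rightarrow> real^'n::{finite,linorder} \<Rightarrow>
     (real^'n::{finite,linorder} \<Rightarrow> 'a::real_normed_vector) \<Rightarrow> ennreal" where
  "herz_morrey_norm \<alpha> l p q f =
     (SUP k0::int. ennreal (2 powr (- of_int k0 * l)) *
        ennreal_powr
          (\<Sum>\<^sub>\<infinity>k\<in>{..k0}. ennreal (2 powr (of_int k * \<alpha> * p)) *
             ennreal_powr (mixed_norm q (restr (annulus k) f)) p)
          (1 / p))"

definition herz_morrey ::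
    "real \<Rightarrow> real \<Rightarrow> real \<Rightarrow> real^'n::{finite,linorder} \<Rightarrow>
     (real^'n::{finite,linorder} \<Rightarrow> 'a::real_normed_vector) set" where
  "herz_morrey \<alpha> l p q = {f \<in> mixed_Lebesgue_loc q. herz_morrey_norm \<alpha> l p q f < \<infinity>}"

text \<open>
  \<open>D\<close> is the domain of the operator; values of \<open>T\<close> outside \<open>D\<close> are irrelevant.
  \<open>D\<close> need not be a vector space: the inequalities are required whenever all
  functions occurring in them belong to \<open>D\<close>.
\<close>

definition sublinear_operator ::
    "(real^'n \<Rightarrow> 'a) set \<Rightarrow>
     ((real^'n \<Rightarrow> 'a) \<Rightarrow> (real^'n \<Rightarrow> 'a::{real_normed_field,euclidean_space})) \<Rightarrow> bool" where
  "sublinear_operator D T \<longleftrightarrow>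
     (\<forall>f\<in>D. T f \<in> borel_measurable lebesgue) \<and>
     (\<forall>f\<in>D. \<forall>g\<in>D. (\<lambda>x. f x + g x) \<in> D \<longrightarrow>
        (AE x in lebesgue. norm (T (\<lambda>x. f x + g x) x) \<le> norm (T f x) + norm (T g x))) \<and>
     (\<forall>c. \<forall>f\<in>D. (\<lambda>x. c * f x) \<in> D \<longrightarrow>
        (AE x in lebesgue. norm (T (\<lambda>x. c * f x) x) = norm c * norm (T f x)))"

definition bounded_operator_on ::
    "'f set \<Rightarrow> ('f \<Rightarrow> ennreal) \<Rightarrow> ('f \<Rightarrow> 'f) \<Rightarrow> bool" where
  "bounded_operator_on X N T \<longleftrightarrow>
     (\<exists>C::real. \<forall>f\<in>X. T f \<in> X \<and> N (T f) \<le> ennreal C * N f)"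

end

theory Submission
  imports Defs
begin

text \<open>
  Split \<open>f\<close> into its annular pieces \<open>f\<^sub>j\<close>. Minkowski's inequality for the mixed norm gives
  \<open>\<parallel>\<chi>\<^sub>k T f\<parallel> \<le> \<Sum>\<^sub>j \<parallel>\<chi>\<^sub>k T f\<^sub>j\<parallel>\<close>. With \<open>s = \<Sum>\<^sub>i 1/q\<^sub>i\<close>, the size conditions,
  Hoelder's inequality \<open>\<parallel>f\<^sub>j\<parallel>\<^sub>1 \<le> C 2\<^bsup>j(n-s)\<^esup> \<parallel>f\<^sub>j\<parallel>\<close> and \<open>\<parallel>\<chi>\<^sub>k\<parallel> \<le> C 2\<^bsup>ks\<^esup>\<close> bound the
  terms with \<open>j \<le> k - 2\<close> by \<open>C 2\<^bsup>-(k-j)(n-s)\<^esup> \<parallel>f\<^sub>j\<parallel>\<close> and those with \<open>j \<ge> k + 2\<close> by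
  \<open>C 2\<^bsup>(k-j)s\<^esup> \<parallel>f\<^sub>j\<parallel>\<close>; the other three are bounded because \<open>T\<close> is bounded on the mixed
  Lebesgue space. Since \<open>l - s < \<alpha> < n - s\<close>, there is \<open>\<epsilon> > 0\<close> with
  \<open>\<parallel>\<chi>\<^sub>k T f\<parallel> \<le> C \<Sum>\<^sub>j 2\<^bsup>(k-j)(l-\<alpha>) - \<epsilon>|k-j|\<^esup> \<parallel>f\<^sub>j\<parallel>\<close>, and convolution with this kernel
  is bounded on the Herz-Morrey sequence space.
\<close>

section \<open>Powers of extended nonnegative reals\<close>

text \<open>Slices of a Lebesgue measurable function need not be measurable, so the estimates for
  iterated integrals are proved for Borel functions and carried over through Borel versions. This
  works because almost every slice of a null set is null. Finite sublinearity says nothing about a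
  sum of infinitely many pieces. If \<open>f\<close> lies in the mixed Lebesgue space, its
  remainders outside finitely many annuli tend to 0 in norm, and boundedness of \<open>T\<close>
  carries the inequality to the limit; for the other functions the inequality is the hypothesis
  \<open>annular_decomposition\<close>. The two halves of the condition on \<alpha> are the gaps n -
  s - \<alpha> > 0 and s + \<alpha> - l > 0, and \<epsilon> is the smaller one. The kernel exponent
  (k-j)(l-\<alpha>) is the growth that the Herz-Morrey norm tolerates exactly: after multiplication
  by 2^(k \<alpha>) it leaves 2^((k-j) l), which offsets the change of the Morrey weight when the
  summation limit moves from k0 to k0 - (k-j).\<close>

lemma ennreal_powr_ennreal [simp]: "0 \<le> x \<Longrightarrow> ennreal_powr (ennreal x) a = ennreal (x powr a)"
  by (simp add: ennreal_powr_def)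

lemma ennreal_powr_top [simp]: "ennreal_powr top a = top"
  by (simp add: ennreal_powr_def)

lemma ennreal_powr_0 [simp]: "ennreal_powr 0 a = 0"
  by (simp add: ennreal_powr_def)

lemma ennreal_powr_1 [simp]: "ennreal_powr t 1 = t"
  by (cases t) (auto simp: ennreal_powr_def)

lemma ennreal_powr_mono: "0 \<le> a \<Longrightarrow> s \<le> t \<Longrightarrow> ennreal_powr s a \<le> ennreal_powr t a"
  by (cases s; cases t) (auto simp: top_unique intro!: ennreal_leI powr_mono2)

lemma ennreal_powr_powr: "ennreal_powr (ennreal_powr t a) b = ennreal_powr t (a * b)"
  by (cases t) (auto simp: powr_powr)

lemma ennreal_powr_inverse [simp]:
  "a \<noteq> 0 \<Longrightarrow> ennreal_powr (ennreal_powr t a) (1 / a) = t"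
  "a \<noteq> 0 \<Longrightarrow> ennreal_powr (ennreal_powr t (1 / a)) a = t"
  by (simp_all add: ennreal_powr_powr)

lemma ennreal_powr_mult:
  assumes "0 < a"
  shows "ennreal_powr (s * t) a = ennreal_powr s a * ennreal_powr t a"
proof (cases s; cases t)
  fix x y assume "s = ennreal x" "t = ennreal y" "0 \<le> x" "0 \<le> y"
  then show ?thesis
    by (simp add: powr_mult flip: ennreal_mult')
next
  fix x assume "s = ennreal x" "t = top" "0 \<le> x"
  then show ?thesis
    by (simp add: ennreal_mult_top)
next
  fix x assume "t = ennreal x" "s = top" "0 \<le> x"
  then show ?thesis
    by (simp add: ennreal_top_mult)
qed auto

lemma ennreal_powr_less_top_iff [simp]: "ennreal_powr t a < top \<longleftrightarrow> t < top"
  by (cases t) auto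

text \<open>Powers with exponents \<open>a\<close> and \<open>1 / a\<close> are mutually inverse and
  monotone, and an order isomorphism preserves suprema.\<close>

lemma ennreal_powr_SUP:
  assumes "0 < a"
  shows "ennreal_powr (SUP i\<in>I. f i) a = (SUP i\<in>I. ennreal_powr (f i) a)"
proof (rule antisym)
  have "(SUP i\<in>I. f i) \<le> ennreal_powr (SUP i\<in>I. ennreal_powr (f i) a) (1 / a)"
  proof (rule SUP_least)
    fix i assume "i \<in> I"
    then have "ennreal_powr (ennreal_powr (f i) a) (1 / a)
        \<le> ennreal_powr (SUP i\<in>I. ennreal_powr (f i) a) (1 / a)"
      using assms by (intro ennreal_powr_mono SUP_upper) auto
    then show "f i \<le> ennreal_powr (SUP i\<in>I. ennreal_powr (f i) a) (1 / a)"
      using assms by simp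
  qed
  then have "ennreal_powr (SUP i\<in>I. f i) a
      \<le> ennreal_powr (ennreal_powr (SUP i\<in>I. ennreal_powr (f i) a) (1 / a)) a"
    using assms by (intro ennreal_powr_mono) auto
  then show "ennreal_powr (SUP i\<in>I. f i) a \<le> (SUP i\<in>I. ennreal_powr (f i) a)"
    using assms by simp
qed (use assms in \<open>auto intro!: SUP_least ennreal_powr_mono SUP_upper\<close>)

lemma borel_measurable_ennreal_powr [measurable (raw)]:
  assumes [measurable]: "f \<in> borel_measurable M"
  shows "(\<lambda>x. ennreal_powr (f x) a) \<in> borel_measurable M"
  unfolding ennreal_powr_def by measurable

lemma tendsto_0_ennreal_powr:
  assumes "0 < a" and f: "(f \<longlongrightarrow> 0) F"
  shows "((\<lambda>x. ennreal_powr (f x) a) \<longlongrightarrow> 0) F"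
proof (rule tendsto_zero_ennreal)
  fix e :: real assume "0 < e"
  \<comment> \<open>Aiming at \<open>e / 2\<close> turns the non-strict bound that monotonicity
    gives into a strict one.\<close>
  then have "\<forall>\<^sub>F x in F. f x < ennreal ((e / 2) powr (1 / a))"
    using f by (intro order_tendstoD) auto
  then show "\<forall>\<^sub>F x in F. ennreal_powr (f x) a < ennreal e"
  proof eventually_elim
    case (elim x)
    then have "ennreal_powr (f x) a \<le> ennreal_powr (ennreal ((e / 2) powr (1 / a))) a"
      using \<open>0 < a\<close> by (intro ennreal_powr_mono) auto
    also have "\<dots> = ennreal (e / 2)"
      using \<open>0 < a\<close> \<open>0 < e\<close> by (simp add: powr_powr)
    also have "\<dots> < ennreal e"
      using \<open>0 < e\<close> by (simp add: ennreal_less_iff)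
    finally show ?case .
  qed
qed

section \<open>Minkowski's and Hoelder's inequalities for a single integral\<close>

lemma powr_add_le_weighted:
  fixes u v :: real
  assumes "1 \<le> p" "0 < \<theta>" "\<theta> < 1" "0 \<le> u" "0 \<le> v"
  shows "(u + v) powr p \<le> \<theta> powr (1 - p) * u powr p + (1 - \<theta>) powr (1 - p) * v powr p"
proof -
  have ge1: "1 \<le> t powr (1 - p)" if "0 < t" "t < 1" for t
    using powr_mono'[of "1 - p" 0 t] that assms(1) by simp
  consider "u = 0" | "v = 0" | "0 < u" "0 < v"
    using assms by linarith
  then show ?thesis
  proof cases
    case 1
    then show ?thesis
      using mult_right_mono[OF ge1[of "1 - \<theta>"], of "v powr p"] assms by simp
  next
    case 2
    then show ?thesis
      using mult_right_mono[OF ge1[of \<theta>], of "u powr p"] assms by simp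
  next
    case 3
    \<comment> \<open>Writing \<open>u + v\<close> as a convex combination of
      \<open>u / \<theta>\<close> and \<open>v / (1 - \<theta>)\<close> leaves \<theta> free, so
      that it can be optimized after integration.\<close>
    have "(\<theta> * (u / \<theta>) + (1 - \<theta>) * (v / (1 - \<theta>))) powr p
        \<le> \<theta> * (u / \<theta>) powr p + (1 - \<theta>) * (v / (1 - \<theta>)) powr p"
      using convex_onD[OF powr_convex[OF assms(1)], of "1 - \<theta>" "u / \<theta>" "v / (1 - \<theta>)"] 3 assms by simp
    moreover have "t * (w / t) powr p = t powr (1 - p) * w powr p" if "0 < t" for t w :: real
      using that by (simp add: powr_divide powr_diff)
    ultimately show ?thesis
      using assms by simp
  qed
qed

lemma ennreal_powr_add_le_weighted:
  assumes "1 \<le> p" "0 < \<theta>" "\<theta> < 1"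
  shows "ennreal_powr (u + v) p
    \<le> ennreal (\<theta> powr (1 - p)) * ennreal_powr u p + ennreal ((1 - \<theta>) powr (1 - p)) * ennreal_powr v p"
proof (cases u; cases v)
  fix x y assume *: "u = ennreal x" "v = ennreal y" "0 \<le> x" "0 \<le> y"
  have "ennreal_powr (u + v) p = ennreal ((x + y) powr p)"
    using * by (simp flip: ennreal_plus)
  also have "\<dots> \<le> ennreal (\<theta> powr (1 - p) * x powr p + (1 - \<theta>) powr (1 - p) * y powr p)"
    using * assms by (intro ennreal_leI powr_add_le_weighted) auto
  also have "\<dots> = ennreal (\<theta> powr (1 - p)) * ennreal_powr u p + ennreal ((1 - \<theta>) powr (1 - p)) * ennreal_powr v p"
    using * by (simp add: ennreal_mult')
  finally show ?thesis .
qed (use assms in \<open>auto simp: ennreal_mult_top\<close>)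

text \<open>Integrate the weighted pointwise inequality and choose \<theta> as the share of the norm
  of \<open>u\<close> in the sum of both norms; at this value the two terms add up to the p-th power
  of that sum.\<close>

lemma nn_integral_Minkowski:
  assumes [measurable]: "u \<in> borel_measurable M" "v \<in> borel_measurable M" and p: "1 \<le> p"
  shows "ennreal_powr (\<integral>\<^sup>+x. ennreal_powr (u x + v x) p \<partial>M) (1 / p)
    \<le> ennreal_powr (\<integral>\<^sup>+x. ennreal_powr (u x) p \<partial>M) (1 / p)
      + ennreal_powr (\<integral>\<^sup>+x. ennreal_powr (v x) p \<partial>M) (1 / p)" (is "?L \<le> ?A + ?B")
proof (cases "?A = top \<or> ?B = top")
  case False
  then obtain a b where a: "?A = ennreal a" "0 \<le> a" and b: "?B = ennreal b" "0 \<le> b"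
    by (metis ennreal_cases)
  have A: "(\<integral>\<^sup>+x. ennreal_powr (u x) p \<partial>M) = ennreal (a powr p)"
    using a p ennreal_powr_inverse(2)[of p "\<integral>\<^sup>+x. ennreal_powr (u x) p \<partial>M"] by simp
  have B: "(\<integral>\<^sup>+x. ennreal_powr (v x) p \<partial>M) = ennreal (b powr p)"
    using b p ennreal_powr_inverse(2)[of p "\<integral>\<^sup>+x. ennreal_powr (v x) p \<partial>M"] by simp
  show ?thesis
  proof (rule ennreal_le_epsilon)
    fix e :: real assume e: "0 < e"
    \<comment> \<open>Adding \<open>e / 2\<close> keeps \<theta> strictly between 0 and 1 even if a
      norm vanishes; the two additions make up the error \<open>e\<close>.\<close>
    define a' b' where "a' = a + e / 2" and "b' = b + e / 2"
    define \<theta> where "\<theta> = a' / (a' + b')"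
    have pos: "0 < a'" "0 < b'" "a \<le> a'" "b \<le> b'"
      using a b e by (auto simp: a'_def b'_def)
    have \<theta>: "0 < \<theta>" "\<theta> < 1" "1 - \<theta> = b' / (a' + b')"
      using pos by (auto simp: \<theta>_def field_simps)
    have scale: "(t / (a' + b')) powr (1 - p) * t powr p = (a' + b') powr p * (t / (a' + b'))"
      if "0 < t" for t
      using that pos by (simp add: powr_divide powr_diff)
    have "(\<integral>\<^sup>+x. ennreal_powr (u x + v x) p \<partial>M)
        \<le> (\<integral>\<^sup>+x. ennreal (\<theta> powr (1 - p)) * ennreal_powr (u x) p
            + ennreal ((1 - \<theta>) powr (1 - p)) * ennreal_powr (v x) p \<partial>M)"
      using p \<theta> by (intro nn_integral_mono ennreal_powr_add_le_weighted) auto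
    also have "\<dots> = ennreal (\<theta> powr (1 - p) * a powr p + (1 - \<theta>) powr (1 - p) * b powr p)"
      by (simp add: nn_integral_add nn_integral_cmult A B ennreal_mult')
    also have "\<dots> \<le> ennreal (\<theta> powr (1 - p) * a' powr p + (1 - \<theta>) powr (1 - p) * b' powr p)"
      using p pos a b by (intro ennreal_leI add_mono mult_left_mono powr_mono2) auto
    also have "\<theta> powr (1 - p) * a' powr p + (1 - \<theta>) powr (1 - p) * b' powr p = (a' + b') powr p"
      using scale[OF pos(1)] scale[OF pos(2)] pos
      unfolding \<theta>(3) by (simp add: \<theta>_def flip: distrib_left add_divide_distrib)
    finally have "?L \<le> ennreal_powr (ennreal ((a' + b') powr p)) (1 / p)"
      using p by (intro ennreal_powr_mono) auto
    also have "\<dots> = ennreal (a + b + e)"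
    proof -
      have "((a' + b') powr p) powr (1 / p) = a + b + e"
        using p pos by (simp add: powr_powr) (simp add: a'_def b'_def)
      then show ?thesis
        by (metis ennreal_powr_ennreal powr_ge_zero)
    qed
    also have "\<dots> = ?A + ?B + ennreal e"
      using a b e by simp
    finally show "?L \<le> ?A + ?B + ennreal e" .
  qed
qed auto

text \<open>Young's inequality in tangent form: the concave map y^(1/q) lies below its tangent at y
  = c^q, applied to y = h^q. Equality holds at h = c, so \<open>c\<close> acts as a guess for the
  size of \<open>h\<close>.\<close>

lemma le_weighted_powr:
  fixes h c :: real
  assumes "1 \<le> q" "0 < c" "0 \<le> h"
  shows "h \<le> c powr (1 - q) / q * h powr q + (1 - 1 / q) * c"
proof (cases "h = 0")
  case False
  then have "0 < h" using assms by simp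
  have "(c powr (1 - q) * h powr q) powr (1 / q) * c powr (1 - 1 / q)
      \<le> 1 / q * (c powr (1 - q) * h powr q) + (1 - 1 / q) * c"
    using assms False by (intro Youngs_inequality_0) auto
  moreover have "(1 - q) * (1 / q) + (1 - 1 / q) = 0"
    using assms by (simp add: field_simps)
  then have "c powr ((1 - q) / q) * c powr (1 - 1 / q) = 1"
    using assms by (simp flip: powr_add)
  then have "(c powr (1 - q) * h powr q) powr (1 / q) * c powr (1 - 1 / q) = h"
    using assms \<open>0 < h\<close> by (simp add: powr_mult powr_powr algebra_simps)
  ultimately show ?thesis by simp
qed (use assms in simp)

text \<open>Hoelder's inequality with the indicator of \<open>A\<close> as second factor: integrate
  the tangent bound over \<open>A\<close>, then optimize the contact point \<open>c\<close>.\<close>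

lemma nn_integral_le_powr_nn_integral_powr:
  assumes [measurable]: "h \<in> borel_measurable M" "A \<in> sets M"
    and "1 \<le> q" and supp: "\<And>x. x \<notin> A \<Longrightarrow> h x = 0" and m: "emeasure M A \<le> ennreal m" "0 < m"
  shows "(\<integral>\<^sup>+x. h x \<partial>M)
    \<le> ennreal (m powr (1 - 1 / q)) * ennreal_powr (\<integral>\<^sup>+x. ennreal_powr (h x) q \<partial>M) (1 / q)"
    (is "?L \<le> ?c * ?B")
proof (cases "?B = top")
  case True
  then show ?thesis using m by (simp add: ennreal_mult_top)
next
  case False
  then obtain b where b: "?B = ennreal b" "0 \<le> b"
    by (metis ennreal_cases)
  have B: "(\<integral>\<^sup>+x. ennreal_powr (h x) q \<partial>M) = ennreal (b powr q)"
    using b assms ennreal_powr_inverse(2)[of q "\<integral>\<^sup>+x. ennreal_powr (h x) q \<partial>M"] by simp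
  show ?thesis
  proof (rule ennreal_le_epsilon)
    fix e :: real assume e: "0 < e"
    \<comment> \<open>A constant c on a set of measure m has q-norm c m^(1/q), so this
      \<open>c\<close> makes the bound sharp for constants. The shift of \<open>b\<close> keeps
      \<open>c\<close> positive and costs exactly \<open>e\<close> after multiplication by
      \<open>m powr (1 - 1 / q)\<close>.\<close>
    define b' where "b' = b + e / m powr (1 - 1 / q)"
    define c where "c = b' / m powr (1 / q)"
    have b': "b \<le> b'" "0 < b'"
      using e b m by (auto simp: b'_def intro!: add_nonneg_pos)
    have c: "0 < c" using b' m by (simp add: c_def)
    have pointwise: "h x \<le> ennreal (c powr (1 - q) / q) * ennreal_powr (h x) q
        + ennreal ((1 - 1 / q) * c) * indicator A x" for x
    proof (cases "x \<in> A")
      case True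
      show ?thesis
      proof (cases "h x")
        case (real y)
        have "h x \<le> ennreal (c powr (1 - q) / q * y powr q + (1 - 1 / q) * c)"
          unfolding real(2) by (intro ennreal_leI le_weighted_powr) (use assms c real in auto)
        also have "\<dots> = ennreal (c powr (1 - q) / q) * ennreal (y powr q) + ennreal ((1 - 1 / q) * c)"
          using assms c by (simp add: ennreal_mult'[symmetric] del: times_divide_eq_left flip: ennreal_plus)
        finally show ?thesis
          using real True by simp
      qed (use c assms in \<open>simp add: ennreal_mult_top\<close>)
    qed (simp add: supp)
    have "?L \<le> (\<integral>\<^sup>+x. ennreal (c powr (1 - q) / q) * ennreal_powr (h x) q
        + ennreal ((1 - 1 / q) * c) * indicator A x \<partial>M)"
      by (intro nn_integral_mono pointwise)
    also have "\<dots> = ennreal (c powr (1 - q) / q * b powr q) + ennreal ((1 - 1 / q) * c) * emeasure M A"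
      using assms(3) by (simp add: nn_integral_add nn_integral_cmult nn_integral_cmult_indicator B ennreal_mult'
          del: times_divide_eq_left)
    also have "\<dots> \<le> ennreal (c powr (1 - q) / q * b' powr q) + ennreal ((1 - 1 / q) * c) * ennreal m"
      using b' b c assms by (intro add_mono ennreal_leI mult_left_mono powr_mono2) auto
    also have "\<dots> = ennreal (c powr (1 - q) / q * b' powr q + (1 - 1 / q) * c * m)"
      using c assms by (subst ennreal_plus) (auto simp: ennreal_mult')
    also have "c powr (1 - q) / q * b' powr q + (1 - 1 / q) * c * m = b' * m powr (1 - 1 / q)"
    proof -
      have "c powr (1 - q) * b' powr q = b' * m powr (1 - 1 / q)"
      proof -
        have "(m powr (1 / q)) powr (1 - q) = m powr (1 / q - 1)"
          using assms by (simp add: powr_powr field_simps)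
        then have "c powr (1 - q) = b' powr (1 - q) / m powr (1 / q - 1)"
          by (simp add: c_def powr_divide)
        then show ?thesis
          using b' m by (simp add: powr_diff)
      qed
      moreover have "c * m = b' * m powr (1 - 1 / q)"
        using m by (simp add: c_def powr_diff)
      ultimately show ?thesis
        using assms by (simp add: field_simps)
    qed
    also have "\<dots> = m powr (1 - 1 / q) * b + e"
      using m by (simp add: b'_def field_simps)
    also have "ennreal \<dots> = ?c * ?B + ennreal e"
      using b e by (simp add: ennreal_mult')
    finally show "?L \<le> ?c * ?B + ennreal e" .
  qed
qed

section \<open>Iterated coordinate norms\<close>

definition upd :: "real^'n \<Rightarrow> 'n \<Rightarrow> real \<Rightarrow> real^'n" where
  "upd x i t = (\<chi> j. if j = i then t else x $ j)"

lemma upd_nth [simp]: "upd x i t $ j = (if j = i then t else x $ j)"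
  by (simp add: upd_def)

lemma upd_eq_translate: "upd x i t = (t - x $ i) *\<^sub>R axis i 1 + x"
  by (simp add: vec_eq_iff axis_def)

lemma borel_measurable_vec_nth_raw [measurable (raw)]:
  fixes f :: "'a \<Rightarrow> real^'n"
  assumes [measurable]: "f \<in> borel_measurable M"
  shows "(\<lambda>x. f x $ i) \<in> borel_measurable M"
  by (simp add: cart_eq_inner_axis)

lemma borel_measurable_upd [measurable (raw)]:
  assumes [measurable]: "f \<in> borel_measurable M" "g \<in> borel_measurable M"
  shows "(\<lambda>x. upd (f x) i (g x)) \<in> borel_measurable M"
  unfolding upd_eq_translate by measurable

lemma nn_integral_lborel_translate:
  fixes F :: "'a::euclidean_space \<Rightarrow> ennreal"
  assumes [measurable]: "F \<in> borel_measurable borel"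
  shows "(\<integral>\<^sup>+x. F (c + x) \<partial>lborel) = (\<integral>\<^sup>+x. F x \<partial>lborel)"
proof -
  have "(\<integral>\<^sup>+x. F x \<partial>lborel) = (\<integral>\<^sup>+x. F x \<partial>distr lborel borel ((+) c))"
    by (simp add: lborel_distr_plus)
  also have "\<dots> = (\<integral>\<^sup>+x. F (c + x) \<partial>lborel)"
    by (rule nn_integral_distr) auto
  finally show ?thesis by simp
qed

lemma nn_integral_upd_eq_translate:
  assumes [measurable]: "F \<in> borel_measurable borel"
  shows "(\<integral>\<^sup>+t. F (upd x i t) \<partial>lborel) = (\<integral>\<^sup>+s. F (s *\<^sub>R axis i 1 + x) \<partial>lborel)"
  using nn_integral_lborel_translate[of "\<lambda>t. F (upd x i t)" "x $ i"]
  by (simp add: upd_eq_translate)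

text \<open>
  By translation invariance this is Tonelli's theorem for the map \<open>(x, s) \<mapsto> x + s e\<^sub>i\<close>,
  which avoids splitting off the coordinate \<open>i\<close> from the space.
\<close>

lemma nn_integral_weight_slice:
  fixes F :: "real^'n \<Rightarrow> ennreal" and g :: "real \<Rightarrow> ennreal"
  assumes [measurable]: "F \<in> borel_measurable borel" "g \<in> borel_measurable borel"
  shows "(\<integral>\<^sup>+x. g (x $ i) * (\<integral>\<^sup>+t. F (upd x i t) \<partial>lborel) \<partial>lborel)
    = (\<integral>\<^sup>+t. g t \<partial>lborel) * (\<integral>\<^sup>+x. F x \<partial>lborel)"
proof -
  have "(\<integral>\<^sup>+x. g (x $ i) * (\<integral>\<^sup>+t. F (upd x i t) \<partial>lborel) \<partial>lborel)
      = (\<integral>\<^sup>+x. (\<integral>\<^sup>+s. g (x $ i) * F (s *\<^sub>R axis i 1 + x) \<partial>lborel) \<partial>lborel)"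
    by (simp add: nn_integral_upd_eq_translate nn_integral_cmult)
  also have "\<dots> = (\<integral>\<^sup>+s. (\<integral>\<^sup>+x. g (x $ i) * F (s *\<^sub>R axis i 1 + x) \<partial>lborel) \<partial>lborel)"
    by (rule lborel_pair.Fubini') measurable
  also have "\<dots> = (\<integral>\<^sup>+s. (\<integral>\<^sup>+y. g (y $ i - s) * F y \<partial>lborel) \<partial>lborel)"
    using nn_integral_lborel_translate[of "\<lambda>y. g (y $ i - s) * F y" "s *\<^sub>R axis i 1" for s]
    by (simp add: axis_def)
  also have "\<dots> = (\<integral>\<^sup>+y. (\<integral>\<^sup>+s. g (y $ i - s) * F y \<partial>lborel) \<partial>lborel)"
    by (rule lborel_pair.Fubini') measurable
  also have "\<dots> = (\<integral>\<^sup>+y. (\<integral>\<^sup>+s. g s \<partial>lborel) * F y \<partial>lborel)"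
  proof (rule nn_integral_cong)
    fix y :: "real^'n"
    have "(\<integral>\<^sup>+s. g s \<partial>lborel) = (\<integral>\<^sup>+s. g (y $ i - s) \<partial>lborel)"
      using nn_integral_real_affine[of g "-1" "y $ i"] by simp
    then show "(\<integral>\<^sup>+s. g (y $ i - s) * F y \<partial>lborel) = (\<integral>\<^sup>+s. g s \<partial>lborel) * F y"
      by (simp add: nn_integral_multc)
  qed
  also have "\<dots> = (\<integral>\<^sup>+t. g t \<partial>lborel) * (\<integral>\<^sup>+x. F x \<partial>lborel)"
    by (rule nn_integral_cmult) simp
  finally show ?thesis .
qed

text \<open>Integrate the indicator of the exceptional set with weight 1. The weight has infinite
  total mass, so its product with the integral of \<open>F\<close> vanishes exactly when that
  integral does.\<close>

lemma AE_upd_iff: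
  fixes P :: "real^'n \<Rightarrow> bool"
  assumes [measurable]: "Measurable.pred borel P"
  shows "(AE x in lborel. AE t in lborel. P (upd x i t)) \<longleftrightarrow> (AE x in lborel. P x)"
proof -
  define F :: "real^'n \<Rightarrow> ennreal" where "F = indicator {x. \<not> P x}"
  have [measurable]: "F \<in> borel_measurable borel"
    unfolding F_def by measurable
  have "(AE x in lborel. AE t in lborel. P (upd x i t))
      \<longleftrightarrow> (AE x in lborel. (\<integral>\<^sup>+t. F (upd x i t) \<partial>lborel) = 0)"
    by (subst nn_integral_0_iff_AE) (auto simp: F_def indicator_def)
  also have "\<dots> \<longleftrightarrow> (\<integral>\<^sup>+x. (\<integral>\<^sup>+t. F (upd x i t) \<partial>lborel) \<partial>lborel) = 0"
    by (subst nn_integral_0_iff_AE) auto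
  also have "(\<integral>\<^sup>+x. (\<integral>\<^sup>+t. F (upd x i t) \<partial>lborel) \<partial>lborel)
      = (\<integral>\<^sup>+t. 1 \<partial>(lborel :: real measure)) * (\<integral>\<^sup>+x. F x \<partial>lborel)"
    using nn_integral_weight_slice[of F "\<lambda>_. 1" i] by simp
  also have "\<dots> = 0 \<longleftrightarrow> (\<integral>\<^sup>+x. F x \<partial>lborel) = 0"
    by (simp add: ennreal_top_mult)
  also have "\<dots> \<longleftrightarrow> (AE x in lborel. P x)"
    by (subst nn_integral_0_iff_AE) (auto simp: F_def indicator_def)
  finally show ?thesis .
qed

text \<open>\<open>P\<close> may be non-measurable, so the equivalence is applied to a Borel null
  set that contains the exceptional set.\<close>

lemma AE_upd:
  fixes P :: "real^'n \<Rightarrow> bool"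
  assumes "AE x in lborel. P x"
  shows "AE x in lborel. AE t in lborel. P (upd x i t)"
proof -
  obtain N where N: "{x. \<not> P x} \<subseteq> N" "N \<in> null_sets lborel"
    using assms by (auto simp: eventually_ae_filter)
  then have [measurable]: "N \<in> sets borel" by auto
  have "AE x in lborel. AE t in lborel. upd x i t \<notin> N"
    by (subst AE_upd_iff) (use AE_not_in[OF N(2)] in auto)
  then show ?thesis
  proof eventually_elim
    case (elim x)
    then show ?case
      by eventually_elim (use N(1) in blast)
  qed
qed

text \<open>Still a function on the whole space, but constant in coordinate \<open>i\<close>. The
  root is taken at once and not merged into the next exponent as in \<open>mixed_iter\<close>, so
  that for exponents at least 1 each stage obeys Minkowski's inequality.\<close>

definition coord_norm :: "real \<Rightarrow> 'n \<Rightarrow> (real^'n \<Rightarrow> ennreal) \<Rightarrow> real^'n \<Rightarrow> ennreal" where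
  "coord_norm r i F = (\<lambda>x. ennreal_powr (\<integral>\<^sup>+t. ennreal_powr (F (upd x i t)) r \<partial>lborel) (1 / r))"

lemma borel_measurable_coord_norm [measurable]:
  assumes [measurable]: "F \<in> borel_measurable borel"
  shows "coord_norm r i F \<in> borel_measurable borel"
  unfolding coord_norm_def by measurable

lemma coord_norm_mono:
  "0 < r \<Longrightarrow> (\<And>x. F x \<le> G x) \<Longrightarrow> coord_norm r i F x \<le> coord_norm r i G x"
  unfolding coord_norm_def by (intro ennreal_powr_mono nn_integral_mono) auto

lemma coord_norm_mono_AE:
  assumes "0 < r" "AE x in lborel. F x \<le> G x"
  shows "AE x in lborel. coord_norm r i F x \<le> coord_norm r i G x"
  using AE_upd[OF assms(2), of i]
proof eventually_elim
  case (elim x)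
  show ?case
    unfolding coord_norm_def using assms(1)
    by (intro ennreal_powr_mono nn_integral_mono_AE) (use elim in \<open>auto intro!: ennreal_powr_mono\<close>)
qed

lemma coord_norm_add:
  assumes [measurable]: "F \<in> borel_measurable borel" "G \<in> borel_measurable borel" and "1 \<le> r"
  shows "coord_norm r i (\<lambda>x. F x + G x) x \<le> coord_norm r i F x + coord_norm r i G x"
  unfolding coord_norm_def by (rule nn_integral_Minkowski) (use assms in auto)

lemma coord_norm_cmult:
  assumes [measurable]: "F \<in> borel_measurable borel" and "0 < r"
  shows "coord_norm r i (\<lambda>x. c * F x) x = c * coord_norm r i F x"
  using assms by (simp add: coord_norm_def ennreal_powr_mult nn_integral_cmult)

lemma coord_norm_SUP:
  assumes [measurable]: "\<And>n. F n \<in> borel_measurable borel" and "incseq F" "0 < r"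
  shows "coord_norm r i (\<lambda>x. SUP n. F n x) x = (SUP n. coord_norm r i (F n) x)"
proof -
  have "incseq (\<lambda>n t. ennreal_powr (F n (upd x i t)) r)"
    using assms(3) le_funD[OF incseqD[OF assms(2)]]
    by (intro monoI le_funI ennreal_powr_mono) auto
  then have "(\<integral>\<^sup>+t. (SUP n. ennreal_powr (F n (upd x i t)) r) \<partial>lborel)
      = (SUP n. \<integral>\<^sup>+t. ennreal_powr (F n (upd x i t)) r \<partial>lborel)"
    by (rule nn_integral_monotone_convergence_SUP) simp
  then show ?thesis
    using assms(3) by (simp add: coord_norm_def ennreal_powr_SUP)
qed

lemma AE_coord_norm_finite:
  assumes [measurable]: "F \<in> borel_measurable borel" and "0 < r"
    and fin: "AE x in lborel. coord_norm r i F x < top"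
  shows "AE x in lborel. F x < top"
proof (subst AE_upd_iff[symmetric, of _ i])
  show "AE x in lborel. AE t in lborel. F (upd x i t) < top"
    using fin
  proof eventually_elim
    case (elim x)
    then have "(\<integral>\<^sup>+t. ennreal_powr (F (upd x i t)) r \<partial>lborel) \<noteq> \<infinity>"
      by (simp add: coord_norm_def)
    from nn_integral_PInf_AE[OF _ this] show ?case
      by (simp add: less_top[symmetric]) (metis (mono_tags, lifting) AE_mp AE_I2 ennreal_powr_top)
  qed
qed simp

text \<open>Dominated convergence on almost every line parallel to axis \<open>i\<close>; finiteness
  of \<open>coord_norm r i G\<close> makes \<open>G\<close> an admissible majorant on that
  line.\<close>

lemma coord_norm_tendsto_0:
  assumes [measurable]: "\<And>n. F n \<in> borel_measurable borel" "G \<in> borel_measurable borel" and "0 < r"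
    and le: "\<And>n x. F n x \<le> G x"
    and lim: "AE x in lborel. (\<lambda>n. F n x) \<longlonglongrightarrow> 0"
    and fin: "AE x in lborel. coord_norm r i G x < top"
  shows "AE x in lborel. (\<lambda>n. coord_norm r i (F n) x) \<longlonglongrightarrow> 0"
  using fin AE_upd[OF lim, of i]
proof eventually_elim
  case (elim x)
  have "(\<lambda>n. \<integral>\<^sup>+t. ennreal_powr (F n (upd x i t)) r \<partial>lborel) \<longlonglongrightarrow> (\<integral>\<^sup>+t. 0 \<partial>(lborel :: real measure))"
  proof (rule nn_integral_dominated_convergence)
    show "(\<integral>\<^sup>+t. ennreal_powr (G (upd x i t)) r \<partial>lborel) < \<infinity>"
      using elim(1) by (simp add: coord_norm_def)
    show "AE t in lborel. ennreal_powr (F n (upd x i t)) r \<le> ennreal_powr (G (upd x i t)) r" for n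
      using le \<open>0 < r\<close> by (auto intro!: ennreal_powr_mono)
    show "AE t in lborel. (\<lambda>n. ennreal_powr (F n (upd x i t)) r) \<longlonglongrightarrow> 0"
      using elim(2) by eventually_elim (use \<open>0 < r\<close> in \<open>auto intro: tendsto_0_ennreal_powr\<close>)
  qed auto
  then show ?case
    using \<open>0 < r\<close> by (auto simp: coord_norm_def intro!: tendsto_0_ennreal_powr)
qed

section \<open>Iterated norms, by induction over the coordinates\<close>

primrec iter_norm :: "real^'n \<Rightarrow> 'n list \<Rightarrow> (real^'n \<Rightarrow> ennreal) \<Rightarrow> real^'n \<Rightarrow> ennreal" where
  "iter_norm q [] F = F"
| "iter_norm q (i # is) F = iter_norm q is (coord_norm (q $ i) i F)"

text \<open>The parameter \<open>r\<close> of \<open>mixed_iter\<close> is the root still owed for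
  the previous coordinate; taking it beforehand turns the exponent \<open>q $ i / r\<close> into
  \<open>q $ i\<close>. The inner integrals over \<open>lebesgue\<close> and \<open>lborel\<close>
  agree because completion does not change \<open>nn_integral\<close>.\<close>

lemma mixed_iter_eq_iter_norm:
  assumes "\<And>i. 0 < q $ i" "0 < r"
  shows "mixed_iter q r is F = iter_norm q is (\<lambda>x. ennreal_powr (F x) (1 / r))"
  using assms(2)
proof (induction "is" arbitrary: r F)
  case (Cons i "is")
  have "coord_norm (q $ i) i (\<lambda>x. ennreal_powr (F x) (1 / r))
      = (\<lambda>x. ennreal_powr (\<integral>\<^sup>+t. ennreal_powr (F (\<chi> j. if j = i then t else x $ j)) (q $ i / r) \<partial>lebesgue) (1 / q $ i))"
    by (simp add: coord_norm_def ennreal_powr_powr nn_integral_completion upd_def)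
  then show ?case
    using Cons.IH[OF assms(1)[of i]] by simp
qed simp

context
  fixes q :: "real^'n"
  assumes q: "\<And>i. 1 \<le> q $ i"
begin

lemma q_pos: "0 < q $ i"
  using q[of i] by simp

lemma iter_norm_mono: "(\<And>x. F x \<le> G x) \<Longrightarrow> iter_norm q is F x \<le> iter_norm q is G x"
proof (induction "is" arbitrary: F G)
  case (Cons i "is")
  show ?case
    by (simp, rule Cons.IH, rule coord_norm_mono) (use q_pos Cons.prems in auto)
qed simp

lemma iter_norm_mono_AE:
  "AE x in lborel. F x \<le> G x \<Longrightarrow> AE x in lborel. iter_norm q is F x \<le> iter_norm q is G x"
proof (induction "is" arbitrary: F G)
  case (Cons i "is")
  show ?case
    using Cons.IH[OF coord_norm_mono_AE[OF q_pos Cons.prems]] by simp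
qed simp

lemma iter_norm_add:
  assumes "F \<in> borel_measurable borel" "G \<in> borel_measurable borel"
  shows "iter_norm q is (\<lambda>x. F x + G x) x \<le> iter_norm q is F x + iter_norm q is G x"
  using assms
proof (induction "is" arbitrary: F G)
  case (Cons i "is")
  have "iter_norm q (i # is) (\<lambda>x. F x + G x) x
      \<le> iter_norm q is (\<lambda>x. coord_norm (q $ i) i F x + coord_norm (q $ i) i G x) x"
    by (simp, rule iter_norm_mono, rule coord_norm_add) (use q Cons.prems in auto)
  also have "\<dots> \<le> iter_norm q (i # is) F x + iter_norm q (i # is) G x"
    using Cons.IH[of "coord_norm (q $ i) i F" "coord_norm (q $ i) i G"] Cons.prems by simp
  finally show ?case .
qed simp

lemma iter_norm_cmult:
  assumes "F \<in> borel_measurable borel"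
  shows "iter_norm q is (\<lambda>x. c * F x) x = c * iter_norm q is F x"
  using assms
proof (induction "is" arbitrary: F)
  case (Cons i "is")
  have "coord_norm (q $ i) i (\<lambda>x. c * F x) = (\<lambda>x. c * coord_norm (q $ i) i F x)"
    using Cons.prems q_pos by (intro ext coord_norm_cmult) auto
  then show ?case
    using Cons by simp
qed simp

lemma iter_norm_SUP:
  assumes "\<And>n. F n \<in> borel_measurable borel" "incseq F"
  shows "iter_norm q is (\<lambda>x. SUP n. F n x) x = (SUP n. iter_norm q is (F n) x)"
  using assms
proof (induction "is" arbitrary: F)
  case (Cons i "is")
  have "coord_norm (q $ i) i (\<lambda>x. SUP n. F n x) = (\<lambda>x. SUP n. coord_norm (q $ i) i (F n) x)"
    using Cons.prems q_pos by (intro ext coord_norm_SUP) auto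
  moreover have "incseq (\<lambda>n. coord_norm (q $ i) i (F n))"
    using le_funD[OF incseqD[OF Cons.prems(2)]] q_pos by (intro monoI le_funI coord_norm_mono) auto
  ultimately show ?case
    using Cons.IH[of "\<lambda>n. coord_norm (q $ i) i (F n)"] Cons.prems by simp
qed simp

lemma AE_iter_norm_finite:
  assumes "F \<in> borel_measurable borel" "AE x in lborel. iter_norm q is F x < top"
  shows "AE x in lborel. F x < top"
  using assms
proof (induction "is" arbitrary: F)
  case (Cons i "is")
  have "AE x in lborel. coord_norm (q $ i) i F x < top"
    using Cons.prems by (intro Cons.IH[of "coord_norm (q $ i) i F"]) auto
  then show ?case
    by (rule AE_coord_norm_finite[OF Cons.prems(1) q_pos])
qed simp

text \<open>Each stage needs an almost everywhere finite majorant. The last norm of \<open>G\<close>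
  has this property, and \<open>AE_iter_norm_finite\<close> passes it back to the earlier
  stages.\<close>

lemma iter_norm_tendsto_0:
  assumes "\<And>n. F n \<in> borel_measurable borel" "G \<in> borel_measurable borel"
    and "\<And>n x. F n x \<le> G x"
    and "AE x in lborel. (\<lambda>n. F n x) \<longlonglongrightarrow> 0"
    and "AE x in lborel. iter_norm q is G x < top"
  shows "AE x in lborel. (\<lambda>n. iter_norm q is (F n) x) \<longlonglongrightarrow> 0"
  using assms
proof (induction "is" arbitrary: F G)
  case (Cons i "is")
  have fin: "AE x in lborel. coord_norm (q $ i) i G x < top"
    using Cons.prems by (intro AE_iter_norm_finite[of "coord_norm (q $ i) i G" "is"]) auto
  show ?case
    unfolding iter_norm.simps
  proof (rule Cons.IH)
    show "AE x in lborel. (\<lambda>n. coord_norm (q $ i) i (F n) x) \<longlonglongrightarrow> 0"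
      by (rule coord_norm_tendsto_0[of F G]) (use Cons.prems fin q_pos in auto)
    show "coord_norm (q $ i) i (F n) x \<le> coord_norm (q $ i) i G x" for n x
      using Cons.prems q_pos by (intro coord_norm_mono) auto
  qed (use Cons.prems in auto)
qed simp

text \<open>\<open>S\<close> records coordinates on which \<open>F\<close> no longer depends. Once
  every coordinate is integrated the norm is constant, which is why evaluation at 0 loses
  nothing.\<close>

lemma iter_norm_cong_coords:
  assumes "\<And>x y. (\<And>j. j \<notin> S \<Longrightarrow> x $ j = y $ j) \<Longrightarrow> F x = F y"
    and "\<And>j. j \<notin> S \<union> set is \<Longrightarrow> x $ j = y $ j"
  shows "iter_norm q is F x = iter_norm q is F y"
  using assms
proof (induction "is" arbitrary: F S)
  case Nil
  have "F x = F y"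
    by (rule Nil.prems(1)) (use Nil.prems(2) in simp)
  then show ?case by simp
next
  case (Cons i "is")
  show ?case
    unfolding iter_norm.simps
  proof (rule Cons.IH[of "insert i S"])
    fix x y :: "real^'n" assume "\<And>j. j \<notin> insert i S \<Longrightarrow> x $ j = y $ j"
    then have "F (upd x i t) = F (upd y i t)" for t
      by (intro Cons.prems) auto
    then show "coord_norm (q $ i) i F x = coord_norm (q $ i) i F y"
      by (simp add: coord_norm_def)
  qed (use Cons.prems in auto)
qed

text \<open>Each integration effectively runs over an interval of length 2R and contributes
  (2R)^(1/q_i). As the list is distinct, changing coordinate \<open>i\<close> does not affect the
  vanishing condition in the remaining coordinates.\<close>

lemma iter_norm_le_const:
  assumes "0 < R" "distinct is"
    and "\<And>x. F x \<le> c" and "\<And>x j. j \<in> set is \<Longrightarrow> R < \<bar>x $ j\<bar> \<Longrightarrow> F x = 0"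
  shows "iter_norm q is F x \<le> ennreal ((2 * R) powr (\<Sum>i\<leftarrow>is. 1 / q $ i)) * c"
  using assms(2-)
proof (induction "is" arbitrary: F c)
  case (Cons i "is")
  let ?d = "ennreal ((2 * R) powr (1 / q $ i))"
  have bound: "coord_norm (q $ i) i F x \<le> ?d * c" for x
  proof -
    have "(\<integral>\<^sup>+t. ennreal_powr (F (upd x i t)) (q $ i) \<partial>lborel)
        \<le> (\<integral>\<^sup>+t. ennreal_powr c (q $ i) * indicator {-R..R} t \<partial>lborel)"
    proof (rule nn_integral_mono)
      fix t
      have "F (upd x i t) = 0" if "t \<notin> {-R..R}"
        using Cons.prems(3)[of i "upd x i t"] that by auto
      then show "ennreal_powr (F (upd x i t)) (q $ i) \<le> ennreal_powr c (q $ i) * indicator {-R..R} t"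
        using Cons.prems(2) q_pos[THEN less_imp_le] by (auto simp: indicator_def intro!: ennreal_powr_mono)
    qed
    also have "\<dots> = ennreal_powr c (q $ i) * ennreal (2 * R)"
      using \<open>0 < R\<close> by (simp add: nn_integral_cmult)
    finally have "coord_norm (q $ i) i F x
        \<le> ennreal_powr (ennreal_powr c (q $ i) * ennreal (2 * R)) (1 / q $ i)"
      unfolding coord_norm_def using q_pos[of i] by (intro ennreal_powr_mono) auto
    also have "\<dots> = ?d * c"
      using q_pos[of i] \<open>0 < R\<close> by (simp add: ennreal_powr_mult mult.commute)
    finally show ?thesis .
  qed
  have supp: "coord_norm (q $ i) i F x = 0" if "j \<in> set is" "R < \<bar>x $ j\<bar>" for x j
  proof -
    have "F (upd x i t) = 0" for t
      using Cons.prems(1) that by (intro Cons.prems(3)[of j]) auto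
    then show ?thesis
      by (simp add: coord_norm_def)
  qed
  have "iter_norm q is (coord_norm (q $ i) i F) x
      \<le> ennreal ((2 * R) powr (\<Sum>i\<leftarrow>is. 1 / q $ i)) * (?d * c)"
    by (rule Cons.IH) (use Cons.prems(1) bound supp in auto)
  then show ?case
    by (simp add: powr_add ennreal_mult' mult_ac)
qed (use \<open>0 < R\<close> in simp)

end

text \<open>Hoelder's inequality in each coordinate on an interval of length 2R; the factors (2R)^(1
  - 1/q_i) multiply. The exponent vector \<open>1\<close> has all entries 1, so the left side is a
  plain iterated integral.\<close>

lemma iter_norm_1_le:
  fixes q :: "real^'n"
  assumes q: "\<And>i. 1 \<le> q $ i" and "0 < R" "distinct is" and "F \<in> borel_measurable borel"
    and "\<And>x j. j \<in> set is \<Longrightarrow> R < \<bar>x $ j\<bar> \<Longrightarrow> F x = 0"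
  shows "iter_norm 1 is F x \<le> ennreal ((2 * R) powr (\<Sum>i\<leftarrow>is. 1 - 1 / q $ i)) * iter_norm q is F x"
  using assms(3-)
proof (induction "is" arbitrary: F)
  case (Cons i "is")
  note [measurable] = Cons.prems(2)
  let ?d = "ennreal ((2 * R) powr (1 - 1 / q $ i))"
  let ?K = "ennreal ((2 * R) powr (\<Sum>i\<leftarrow>is. 1 - 1 / q $ i))"
  have bound: "coord_norm 1 i F x \<le> ?d * coord_norm (q $ i) i F x" for x
  proof -
    have "(\<integral>\<^sup>+t. F (upd x i t) \<partial>lborel)
      \<le> ?d * ennreal_powr (\<integral>\<^sup>+t. ennreal_powr (F (upd x i t)) (q $ i) \<partial>lborel) (1 / q $ i)"
    proof (rule nn_integral_le_powr_nn_integral_powr)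
      show "F (upd x i t) = 0" if "t \<notin> {-R..R}" for t
        using Cons.prems(3)[of i "upd x i t"] that by auto
    qed (use q \<open>0 < R\<close> in auto)
    then show ?thesis
      by (simp add: coord_norm_def)
  qed
  have supp: "coord_norm 1 i F x = 0" if "j \<in> set is" "R < \<bar>x $ j\<bar>" for x j
  proof -
    have "F (upd x i t) = 0" for t
      using Cons.prems(1) that by (intro Cons.prems(3)[of j]) auto
    then show ?thesis
      by (simp add: coord_norm_def)
  qed
  have "iter_norm 1 (i # is) F x \<le> ?K * iter_norm q is (coord_norm 1 i F) x"
    using Cons.prems(1) Cons.IH[of "coord_norm 1 i F"] supp by simp
  also have "\<dots> \<le> ?K * iter_norm q is (\<lambda>x. ?d * coord_norm (q $ i) i F x) x"
    by (intro mult_left_mono iter_norm_mono q bound) auto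
  also have "\<dots> = ?K * (?d * iter_norm q (i # is) F x)"
    by (simp add: iter_norm_cmult q)
  finally show ?case
    by (simp add: powr_add ennreal_mult' mult_ac)
qed (use \<open>0 < R\<close> in simp)

text \<open>Connects the integral over the whole space with the iterated one. Integrating out a
  coordinate leaves a function that is constant in it, and a weight of total mass 1 in that
  coordinate keeps the integral over the space unchanged. \<open>J\<close> holds the coordinates
  already treated.\<close>

lemma nn_integral_weight_iter_norm_1:
  fixes F :: "real^'n \<Rightarrow> ennreal" and g :: "real \<Rightarrow> ennreal"
  assumes [measurable]: "g \<in> borel_measurable borel" and g: "(\<integral>\<^sup>+t. g t \<partial>lborel) = 1"
    and "F \<in> borel_measurable borel" "distinct is" "J \<inter> set is = {}"
  shows "(\<integral>\<^sup>+x. (\<Prod>j\<in>J. g (x $ j)) * F x \<partial>lborel)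
    = (\<integral>\<^sup>+x. (\<Prod>j\<in>J \<union> set is. g (x $ j)) * iter_norm 1 is F x \<partial>lborel)"
  using assms(3-)
proof (induction "is" arbitrary: F J)
  case (Cons i "is")
  note [measurable] = Cons.prems(1)
  have i: "i \<notin> J" using Cons.prems by auto
  have "(\<integral>\<^sup>+x. (\<Prod>j\<in>J. g (x $ j)) * F x \<partial>lborel)
      = (\<integral>\<^sup>+x. g (x $ i) * (\<integral>\<^sup>+t. (\<Prod>j\<in>J. g (upd x i t $ j)) * F (upd x i t) \<partial>lborel) \<partial>lborel)"
    using nn_integral_weight_slice[of "\<lambda>x. (\<Prod>j\<in>J. g (x $ j)) * F x" g i] g by simp
  also have "\<dots> = (\<integral>\<^sup>+x. (\<Prod>j\<in>insert i J. g (x $ j)) * coord_norm 1 i F x \<partial>lborel)"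
  proof (rule nn_integral_cong)
    fix x :: "real^'n"
    have "(\<Prod>j\<in>J. g (upd x i t $ j)) = (\<Prod>j\<in>J. g (x $ j))" for t
      using i by (intro prod.cong) auto
    then show "g (x $ i) * (\<integral>\<^sup>+t. (\<Prod>j\<in>J. g (upd x i t $ j)) * F (upd x i t) \<partial>lborel)
        = (\<Prod>j\<in>insert i J. g (x $ j)) * coord_norm 1 i F x"
      using i by (simp add: coord_norm_def nn_integral_cmult mult.assoc)
  qed
  also have "\<dots> = (\<integral>\<^sup>+x. (\<Prod>j\<in>insert i J \<union> set is. g (x $ j)) * iter_norm 1 is (coord_norm 1 i F) x \<partial>lborel)"
    by (rule Cons.IH) (use Cons.prems in auto)
  finally show ?case by simp
qed simp

section \<open>The mixed norm of extended nonnegative functions\<close>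

text \<open>The sets given by \<open>to_nat x < n\<close> are finite, increase with n and absorb
  every finite subset, so a sequence replaces the directed supremum and monotone convergence becomes
  applicable.\<close>

lemma infsum_ennreal_eq_SUP:
  fixes f :: "'b::countable \<Rightarrow> ennreal"
  shows "infsum f A = (SUP n. \<Sum>x\<in>{x\<in>A. to_nat x < n}. f x)"
proof -
  have fin: "finite {x\<in>A. to_nat x < n}" for n
    by (rule finite_subset[OF _ finite_vimageI[OF finite_lessThan[of n] inj_to_nat]]) auto
  have "infsum f A = (SUP S\<in>{S. finite S \<and> S \<subseteq> A}. sum f S)"
    by (rule nonneg_infsum_complete) auto
  also have "\<dots> = (SUP n. \<Sum>x\<in>{x\<in>A. to_nat x < n}. f x)"
  proof (rule antisym)
    show "(SUP S\<in>{S. finite S \<and> S \<subseteq> A}. sum f S) \<le> (SUP n. \<Sum>x\<in>{x\<in>A. to_nat x < n}. f x)"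
    proof (rule SUP_least)
      fix S assume S: "S \<in> {S. finite S \<and> S \<subseteq> A}"
      then have "finite (to_nat ` S)" by simp
      then obtain n where "\<forall>x\<in>S. to_nat x < n"
        unfolding finite_nat_set_iff_bounded by blast
      with S have "sum f S \<le> (\<Sum>x\<in>{x\<in>A. to_nat x < n}. f x)"
        by (intro sum_mono2 fin) auto
      also have "\<dots> \<le> (SUP n. \<Sum>x\<in>{x\<in>A. to_nat x < n}. f x)"
        by (rule SUP_upper) simp
      finally show "sum f S \<le> (SUP n. \<Sum>x\<in>{x\<in>A. to_nat x < n}. f x)" .
    qed
    show "(SUP n. \<Sum>x\<in>{x\<in>A. to_nat x < n}. f x) \<le> (SUP S\<in>{S. finite S \<and> S \<subseteq> A}. sum f S)"
      using fin by (intro SUP_least SUP_upper) auto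
  qed
  finally show ?thesis .
qed

lemma incseq_sum_to_nat:
  fixes f :: "'b::countable \<Rightarrow> ennreal"
  shows "incseq (\<lambda>n. \<Sum>x\<in>{x\<in>A. to_nat x < n}. f x)"
proof (rule monoI)
  fix m n :: nat assume "m \<le> n"
  have "finite {x\<in>A. to_nat x < n}"
    by (rule finite_subset[OF _ finite_vimageI[OF finite_lessThan[of n] inj_to_nat]]) auto
  then show "(\<Sum>x\<in>{x\<in>A. to_nat x < m}. f x) \<le> (\<Sum>x\<in>{x\<in>A. to_nat x < n}. f x)"
    using \<open>m \<le> n\<close> by (intro sum_mono2) auto
qed

text \<open>As integrals over counting measures, sums can be scaled, reindexed along bijections and
  interchanged.\<close>

lemma infsum_ennreal_eq_nn_integral:
  fixes f :: "'b::countable \<Rightarrow> ennreal"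
  shows "infsum f A = (\<integral>\<^sup>+x. f x \<partial>count_space A)"
proof -
  let ?S = "\<lambda>n. {x\<in>A. to_nat x < n}"
  have fin: "finite (?S n)" for n
    by (rule finite_subset[OF _ finite_vimageI[OF finite_lessThan[of n] inj_to_nat]]) auto
  have "f x = (SUP n. f x * indicator (?S n) x)" if "x \<in> A" for x
  proof (rule antisym)
    show "f x \<le> (SUP n. f x * indicator (?S n) x)"
      using that by (intro SUP_upper2[of "Suc (to_nat x)"]) auto
  qed (auto intro!: SUP_least simp: indicator_def)
  then have "(\<integral>\<^sup>+x. f x \<partial>count_space A) = (\<integral>\<^sup>+x. (SUP n. f x * indicator (?S n) x) \<partial>count_space A)"
    by (intro nn_integral_cong) auto
  also have "\<dots> = (SUP n. \<integral>\<^sup>+x. f x * indicator (?S n) x \<partial>count_space A)"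
    by (rule nn_integral_monotone_convergence_SUP)
       (auto simp: incseq_def le_fun_def indicator_def)
  also have "\<dots> = (SUP n. \<Sum>x\<in>?S n. f x)"
  proof (rule SUP_cong)
    fix n
    have "(\<integral>\<^sup>+x. f x * indicator (?S n) x \<partial>count_space A) = (\<Sum>x\<in>?S n. f x * indicator (?S n) x)"
      by (rule nn_integral_count_space'[OF fin]) auto
    also have "\<dots> = (\<Sum>x\<in>?S n. f x)"
      by (intro sum.cong) auto
    finally show "(\<integral>\<^sup>+x. f x * indicator (?S n) x \<partial>count_space A) = (\<Sum>x\<in>?S n. f x)" .
  qed simp
  finally show ?thesis
    by (simp add: infsum_ennreal_eq_SUP)
qed

section \<open>Borel versions and the norm of Lebesgue measurable functions\<close>

lemma lebesgue_measurable_borel_version: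
  fixes F :: "'e::euclidean_space \<Rightarrow> ennreal"
  assumes "F \<in> borel_measurable lebesgue"
  obtains F' where "F' \<in> borel_measurable borel" "AE x in lebesgue. F x = F' x"
  using completion_ex_borel_measurable[OF assms] by (auto simp: AE_completion_iff)

text \<open>Since fully iterated norms are constant, almost everywhere comparisons between them are
  statements about fixed numbers; this lemma strips the quantifier.\<close>

lemma AE_lborel_const [simp]: "(AE x in (lborel :: 'e::euclidean_space measure). P) \<longleftrightarrow> P"
proof (cases P)
  case False
  have "\<not> (AE x in (lborel :: 'e measure). False)"
    using emeasure_lborel_UNIV[where 'a='e] by (simp add: AE_iff_null null_sets_def)
  with False show ?thesis by simp
qed simp

text \<open>Kept apart from the norm of the values so that it applies to functions with value
  infinity, such as sums over all annuli.\<close>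

definition total_norm :: "real^'n::{finite,linorder} \<Rightarrow> (real^'n::{finite,linorder} \<Rightarrow> ennreal) \<Rightarrow> ennreal" where
  "total_norm q F = iter_norm q (sorted_list_of_set UNIV) F 0"

lemma mixed_norm_eq_total_norm:
  assumes "\<And>i. 0 < q $ i"
  shows "mixed_norm q f = total_norm q (\<lambda>x. ennreal (norm (f x)))"
  using assms by (simp add: mixed_norm_def total_norm_def mixed_iter_eq_iter_norm)

text \<open>With the indicator of [0, 1] as weight, the product of the weights is the indicator of
  the unit cube, and a constant integrated over a set of measure 1 is itself.\<close>

lemma nn_integral_lborel_le_total_norm_1:
  fixes F :: "real^'n::{finite,linorder} \<Rightarrow> ennreal"
  assumes "F \<in> borel_measurable borel"
  shows "(\<integral>\<^sup>+x. F x \<partial>lborel) \<le> total_norm 1 F"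
proof -
  define u :: "real^'n::{finite,linorder}" where "u = \<Sum>Basis"
  have u: "u $ j = 1" for j
    unfolding u_def using inner_sum_Basis[of "axis j 1 :: real^'n::{finite,linorder}"] by (simp add: cart_eq_inner_axis)
  have cube: "(\<Prod>j\<in>UNIV. indicator {0..1::real} (x $ j) :: ennreal) = indicator (cbox 0 u) x" for x
    by (auto simp: indicator_def mem_box_cart u intro: prod_zero)
  have const: "iter_norm 1 (sorted_list_of_set UNIV) F x = total_norm 1 F" for x
    unfolding total_norm_def
    by (rule iter_norm_cong_coords[where S="{}"]) (auto simp: vec_eq_iff intro!: arg_cong[where f=F])
  have "(\<integral>\<^sup>+x. F x \<partial>lborel)
      = (\<integral>\<^sup>+x. (\<Prod>j\<in>UNIV. indicator {0..1} (x $ j)) * iter_norm 1 (sorted_list_of_set UNIV) F x \<partial>lborel)"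
    using nn_integral_weight_iter_norm_1[of "indicator {0..1}" F "sorted_list_of_set UNIV" "{}"] assms
    by simp
  also have "\<dots> = emeasure lborel (cbox 0 u) * total_norm 1 F"
    unfolding cube const by (simp add: nn_integral_multc)
  also have "emeasure lborel (cbox 0 u) = 1"
    by (subst emeasure_lborel_cbox) (auto simp: u_def)
  finally show ?thesis by simp
qed

context
  fixes q :: "real^'n::{finite,linorder}"
  assumes q: "\<And>i. 1 \<le> q $ i"
begin

lemma iter_norm_eq_total_norm: "iter_norm q (sorted_list_of_set UNIV) F x = total_norm q F"
  unfolding total_norm_def
  by (rule iter_norm_cong_coords[OF q, where S="{}"]) (auto simp: vec_eq_iff intro!: arg_cong[where f=F])

lemma total_norm_mono_AE:
  assumes "AE x in lebesgue. F x \<le> G x"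
  shows "total_norm q F \<le> total_norm q G"
proof (rule ccontr)
  assume "\<not> total_norm q F \<le> total_norm q G"
  moreover have "AE x in lborel. iter_norm q (sorted_list_of_set UNIV) F x
      \<le> iter_norm q (sorted_list_of_set UNIV) G x"
    using assms q by (intro iter_norm_mono_AE) (auto simp: AE_completion_iff)
  ultimately have "AE x in (lborel :: (real^'n::{finite,linorder}) measure). False"
    by (simp add: iter_norm_eq_total_norm)
  then show False
    by simp
qed

lemma total_norm_mono: "(\<And>x. F x \<le> G x) \<Longrightarrow> total_norm q F \<le> total_norm q G"
  by (rule total_norm_mono_AE) simp

lemma total_norm_cong_AE: "AE x in lebesgue. F x = G x \<Longrightarrow> total_norm q F = total_norm q G"
  by (intro antisym total_norm_mono_AE) auto

lemma total_norm_0 [simp]: "total_norm q (\<lambda>x. 0) = 0"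
  using iter_norm_cmult[OF q, where F="\<lambda>_. 0" and c=0] by (simp add: total_norm_def)

lemma total_norm_add:
  assumes "F \<in> borel_measurable lebesgue" "G \<in> borel_measurable lebesgue"
  shows "total_norm q (\<lambda>x. F x + G x) \<le> total_norm q F + total_norm q G"
proof -
  obtain F' where F': "F' \<in> borel_measurable borel" "AE x in lebesgue. F x = F' x"
    by (rule lebesgue_measurable_borel_version[OF assms(1)])
  obtain G' where G': "G' \<in> borel_measurable borel" "AE x in lebesgue. G x = G' x"
    by (rule lebesgue_measurable_borel_version[OF assms(2)])
  have "total_norm q (\<lambda>x. F x + G x) = total_norm q (\<lambda>x. F' x + G' x)"
    by (rule total_norm_cong_AE) (use F'(2) G'(2) in eventually_elim, simp)
  also have "\<dots> \<le> total_norm q F' + total_norm q G'"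
    unfolding total_norm_def by (rule iter_norm_add[OF q F'(1) G'(1)])
  also have "\<dots> = total_norm q F + total_norm q G"
    using F'(2) G'(2) by (simp add: total_norm_cong_AE)
  finally show ?thesis .
qed

lemma total_norm_sum:
  assumes "finite S" "\<And>j. j \<in> S \<Longrightarrow> F j \<in> borel_measurable lebesgue"
  shows "total_norm q (\<lambda>x. \<Sum>j\<in>S. F j x) \<le> (\<Sum>j\<in>S. total_norm q (F j))"
  using assms
proof (induction S rule: finite_induct)
  case (insert j S)
  have "total_norm q (\<lambda>x. \<Sum>j\<in>insert j S. F j x) = total_norm q (\<lambda>x. F j x + (\<Sum>j\<in>S. F j x))"
    using insert.hyps by simp
  also have "\<dots> \<le> total_norm q (F j) + total_norm q (\<lambda>x. \<Sum>j\<in>S. F j x)"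
    using insert.prems by (intro total_norm_add borel_measurable_sum) auto
  also have "\<dots> \<le> total_norm q (F j) + (\<Sum>j\<in>S. total_norm q (F j))"
    using insert by (intro add_left_mono insert.IH) auto
  finally show ?case
    using insert.hyps by simp
qed simp

text \<open>Minkowski's inequality for the partial sums, then monotone convergence. Borel versions
  can replace all pieces at once because countably many null sets have a null union.\<close>

lemma total_norm_infsum:
  fixes F :: "'b::countable \<Rightarrow> real^'n::{finite,linorder} \<Rightarrow> ennreal"
  assumes "\<And>j. F j \<in> borel_measurable lebesgue"
  shows "total_norm q (\<lambda>x. \<Sum>\<^sub>\<infinity>j\<in>UNIV. F j x) \<le> (\<Sum>\<^sub>\<infinity>j\<in>UNIV. total_norm q (F j))"
proof -
  have "\<forall>j. \<exists>G. G \<in> borel_measurable borel \<and> (AE x in lebesgue. F j x = G x)"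
    using lebesgue_measurable_borel_version[OF assms] by metis
  then obtain G where G: "\<And>j. G j \<in> borel_measurable borel" "\<And>j. AE x in lebesgue. F j x = G j x"
    by metis
  have "AE x in lebesgue. \<forall>j. F j x = G j x"
    using G(2) by (simp add: AE_all_countable)
  then have "total_norm q (\<lambda>x. \<Sum>\<^sub>\<infinity>j\<in>UNIV. F j x) = total_norm q (\<lambda>x. \<Sum>\<^sub>\<infinity>j\<in>UNIV. G j x)"
    by (intro total_norm_cong_AE) (auto elim!: eventually_mono)
  also have "\<dots> = total_norm q (\<lambda>x. SUP n. \<Sum>j | to_nat j < n. G j x)"
    by (simp add: infsum_ennreal_eq_SUP)
  also have "\<dots> = (SUP n. total_norm q (\<lambda>x. \<Sum>j | to_nat j < n. G j x))"
    unfolding total_norm_def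
  proof (rule iter_norm_SUP[OF q])
    show "incseq (\<lambda>n x. \<Sum>j | to_nat j < n. G j x)"
      using incseq_sum_to_nat[where A=UNIV and f="\<lambda>j. G j x" for x] by (simp add: incseq_def le_fun_def)
  qed (use G in auto)
  also have "\<dots> \<le> (SUP n. \<Sum>j | to_nat j < n. total_norm q (G j))"
  proof (rule SUP_mono, rule bexI)
    fix n :: nat
    have "finite {j :: 'b. to_nat j < n}"
      by (rule finite_subset[OF _ finite_vimageI[OF finite_lessThan[of n] inj_to_nat]]) auto
    then show "total_norm q (\<lambda>x. \<Sum>j | to_nat j < n. G j x) \<le> (\<Sum>j | to_nat j < n. total_norm q (G j))"
      using G(1) by (intro total_norm_sum) (auto intro: measurable_completion)
  qed simp
  also have "\<dots> = (\<Sum>\<^sub>\<infinity>j\<in>UNIV. total_norm q (F j))"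
    using total_norm_cong_AE[OF G(2)] by (simp add: infsum_ennreal_eq_SUP)
  finally show ?thesis .
qed

text \<open>Dominated convergence with a Borel version of \<open>F\<close> as majorant; it is used
  with the complements of finite unions of annuli as \<open>E n\<close>.\<close>

lemma total_norm_truncate_tendsto_0:
  assumes "F \<in> borel_measurable lebesgue" "total_norm q F < top"
    and [measurable]: "\<And>n. E n \<in> sets borel"
    and E: "AE x in lborel. \<forall>\<^sub>F n in sequentially. x \<notin> E n"
  shows "(\<lambda>n. total_norm q (\<lambda>x. indicator (E n) x * F x)) \<longlonglongrightarrow> 0"
proof -
  obtain G where G [measurable]: "G \<in> borel_measurable borel" and FG: "AE x in lebesgue. F x = G x"
    by (rule lebesgue_measurable_borel_version[OF assms(1)])
  have "AE x in lborel. (\<lambda>n. iter_norm q (sorted_list_of_set UNIV) (\<lambda>x. indicator (E n) x * G x) x) \<longlonglongrightarrow> 0"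
  proof (rule iter_norm_tendsto_0[OF q, where G=G])
    show "AE x in lborel. (\<lambda>n. indicator (E n) x * G x) \<longlonglongrightarrow> 0"
      using E
    proof eventually_elim
      case (elim x)
      then show ?case
        by (intro tendsto_eventually) (auto elim!: eventually_mono)
    qed
    show "AE x in lborel. iter_norm q (sorted_list_of_set UNIV) G x < top"
      using assms(2) total_norm_cong_AE[OF FG] by (simp add: iter_norm_eq_total_norm)
  qed (auto simp: indicator_def)
  then have "AE x in (lborel :: (real^'n::{finite,linorder}) measure). (\<lambda>n. total_norm q (\<lambda>x. indicator (E n) x * G x)) \<longlonglongrightarrow> 0"
    by (simp add: iter_norm_eq_total_norm)
  then have "(\<lambda>n. total_norm q (\<lambda>x. indicator (E n) x * G x)) \<longlonglongrightarrow> 0"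
    by simp
  moreover have "total_norm q (\<lambda>x. indicator (E n) x * F x) = total_norm q (\<lambda>x. indicator (E n) x * G x)" for n
    by (rule total_norm_cong_AE) (use FG in eventually_elim, simp)
  ultimately show ?thesis by simp
qed

lemma total_norm_le_const:
  assumes "0 < R" "AE x in lebesgue. F x \<le> c"
    and "\<And>x j. R < \<bar>x $ j\<bar> \<Longrightarrow> F x = 0"
  shows "total_norm q F \<le> ennreal ((2 * R) powr (\<Sum>i\<in>UNIV. 1 / q $ i)) * c"
proof -
  \<comment> \<open>The bound \<open>c\<close> holds only almost everywhere, while
    \<open>iter_norm_le_const\<close> asks for it at every point.\<close>
  have "total_norm q F = total_norm q (\<lambda>x. min (F x) c)"
    by (rule total_norm_cong_AE) (use assms(2) in eventually_elim, simp add: min_def)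
  also have "\<dots> \<le> ennreal ((2 * R) powr (\<Sum>i\<leftarrow>sorted_list_of_set UNIV. 1 / q $ i)) * c"
    unfolding total_norm_def by (rule iter_norm_le_const[OF q assms(1)]) (use assms(3) in auto)
  finally show ?thesis
    by (simp add: sum_list_distinct_conv_sum_set)
qed

lemma nn_integral_le_total_norm:
  assumes "0 < R" "F \<in> borel_measurable lebesgue"
    and supp: "\<And>x j. R < \<bar>x $ j\<bar> \<Longrightarrow> F x = 0"
  shows "(\<integral>\<^sup>+x. F x \<partial>lebesgue) \<le> ennreal ((2 * R) powr (\<Sum>i\<in>UNIV. 1 - 1 / q $ i)) * total_norm q F"
proof -
  obtain G where G [measurable]: "G \<in> borel_measurable borel" and FG: "AE x in lebesgue. F x = G x"
    by (rule lebesgue_measurable_borel_version[OF assms(2)])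
  \<comment> \<open>The Borel version \<open>G\<close> may be nonzero on a null set outside the
    cube; the cut-off restores the support condition at every point.\<close>
  define H where "H x = (if \<forall>j. \<bar>x $ j\<bar> \<le> R then G x else 0)" for x
  have [measurable]: "H \<in> borel_measurable borel"
    unfolding H_def by measurable
  have FH: "AE x in lebesgue. F x = H x"
    using FG by eventually_elim (use supp in \<open>auto simp: H_def not_le\<close>)
  have "(\<integral>\<^sup>+x. F x \<partial>lebesgue) = (\<integral>\<^sup>+x. H x \<partial>lborel)"
    using nn_integral_cong_AE[OF FH] by (simp add: nn_integral_completion)
  also have "\<dots> \<le> total_norm 1 H"
    by (rule nn_integral_lborel_le_total_norm_1) simp
  also have "\<dots> \<le> ennreal ((2 * R) powr (\<Sum>i\<leftarrow>sorted_list_of_set UNIV. 1 - 1 / q $ i)) * total_norm q H"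
    unfolding total_norm_def
    by (rule iter_norm_1_le[OF q assms(1)]) (auto simp: H_def dest: leD)
  also have "total_norm q H = total_norm q F"
    using total_norm_cong_AE[OF FH] by simp
  finally show ?thesis
    by (simp add: sum_list_distinct_conv_sum_set)
qed

end

section \<open>Discrete convolution estimate\<close>

definition pow2 :: "real \<Rightarrow> ennreal" where
  "pow2 t = ennreal (2 powr t)"

lemma pow2_add: "pow2 (s + t) = pow2 s * pow2 t"
  by (simp add: pow2_def powr_add ennreal_mult')

lemma pow2_0 [simp]: "pow2 0 = 1"
  by (simp add: pow2_def)

lemma pow2_neq_0 [simp]: "pow2 t \<noteq> 0"
  by (simp add: pow2_def)

lemma pow2_less_top [simp]: "pow2 t < top"
  by (simp add: pow2_def)

lemma pow2_mono: "s \<le> t \<Longrightarrow> pow2 s \<le> pow2 t"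
  by (auto simp: pow2_def intro!: ennreal_leI)

lemma ennreal_powr_pow2 [simp]: "ennreal_powr (pow2 t) p = pow2 (t * p)"
  by (simp add: pow2_def powr_powr)

lemma infsum_pow2_abs_finite:
  assumes "0 < \<epsilon>"
  shows "(\<Sum>\<^sub>\<infinity>m\<in>(UNIV::int set). pow2 (- (\<epsilon> * \<bar>of_int m\<bar>))) < top"
proof -
  define r :: real where "r = 2 powr (- \<epsilon>)"
  have r: "0 < r" "r < 1"
    using assms by (auto simp: r_def powr_less_one)
  have term_eq: "pow2 (- (\<epsilon> * \<bar>of_int m\<bar>)) = ennreal (r ^ nat \<bar>m\<bar>)" for m :: int
    by (simp add: pow2_def r_def powr_powr flip: powr_realpow)
  have geo: "(\<Sum>n<N. r ^ n) \<le> 1 / (1 - r)" for N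
    using sum_le_suminf[of "\<lambda>n. r ^ n" "{..<N}"] r suminf_geometric[of r] summable_geometric[of r] by simp
  have "(\<Sum>\<^sub>\<infinity>m\<in>(UNIV::int set). pow2 (- (\<epsilon> * \<bar>of_int m\<bar>))) \<le> ennreal (2 / (1 - r))"
  proof (rule infsum_le_finite_sums)
    fix F :: "int set" assume F: "finite F"
    define N where "N = Suc (nat (Max (insert 0 (abs ` F))))"
    have N: "nat \<bar>m\<bar> < N" if "m \<in> F" for m
    proof -
      have "\<bar>m\<bar> \<le> Max (insert 0 (abs ` F))"
        using F that by (intro Max_ge) auto
      then show ?thesis by (simp add: N_def nat_mono less_Suc_eq_le)
    qed
    have sub: "F \<subseteq> int ` {..<N} \<union> (\<lambda>n. - int n) ` {..<N}"
    proof
      fix m assume "m \<in> F"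
      from N[OF this] have "m \<in> int ` {..<N}" if "0 \<le> m"
        using that by (intro image_eqI[of _ _ "nat m"]) auto
      moreover from N[OF \<open>m \<in> F\<close>] have "m \<in> (\<lambda>n. - int n) ` {..<N}" if "m < 0"
        using that by (intro image_eqI[of _ _ "nat (- m)"]) auto
      ultimately show "m \<in> int ` {..<N} \<union> (\<lambda>n. - int n) ` {..<N}"
        by force
    qed
    have "(\<Sum>m\<in>F. r ^ nat \<bar>m\<bar>) \<le> (\<Sum>m\<in>int ` {..<N} \<union> (\<lambda>n. - int n) ` {..<N}. r ^ nat \<bar>m\<bar>)"
      using sub r by (intro sum_mono2) auto
    \<comment> \<open>The two index ranges share 0, hence only an inequality.\<close>
    also have "\<dots> \<le> (\<Sum>m\<in>int ` {..<N}. r ^ nat \<bar>m\<bar>) + (\<Sum>m\<in>(\<lambda>n. - int n) ` {..<N}. r ^ nat \<bar>m\<bar>)"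
      using r by (subst sum.union_inter[symmetric]) (auto intro!: sum_nonneg)
    also have "\<dots> = (\<Sum>n<N. r ^ n) + (\<Sum>n<N. r ^ n)"
      by (subst (1 2) sum.reindex) (auto simp: inj_on_def)
    also have "\<dots> \<le> 2 / (1 - r)"
      using geo[of N] by simp
    finally show "(\<Sum>m\<in>F. pow2 (- (\<epsilon> * \<bar>of_int m\<bar>))) \<le> ennreal (2 / (1 - r))"
      using r by (simp add: term_eq sum_ennreal ennreal_leI)
  qed (rule nonneg_summable_on_complete, simp)
  then show ?thesis
    using le_less_trans by fastforce
qed

text \<open>
  A geometrically weighted \<open>\<ell>\<^sup>1\<close> sum is controlled by the supremum with
  half of the decay, and the supremum by any \<open>\<ell>\<^sup>p\<close> sum. This treats all
  \<open>p > 0\<close> at once.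
\<close>

lemma powr_weighted_sum_le:
  assumes "0 < \<epsilon>" "0 < p"
  obtains K where "0 \<le> K"
    "\<And>z :: int \<Rightarrow> ennreal.
      ennreal_powr (\<integral>\<^sup>+m. pow2 (- (\<epsilon> * \<bar>of_int m\<bar>)) * z m \<partial>count_space UNIV) p
        \<le> ennreal K * (\<integral>\<^sup>+m. pow2 (- (\<epsilon> * p / 2 * \<bar>of_int m\<bar>)) * ennreal_powr (z m) p \<partial>count_space UNIV)"
proof -
  let ?U = "\<integral>\<^sup>+m. pow2 (- (\<epsilon> / 2 * \<bar>of_int m\<bar>)) \<partial>count_space (UNIV :: int set)"
  have "?U < top"
    using infsum_pow2_abs_finite[of "\<epsilon> / 2"] assms by (simp add: infsum_ennreal_eq_nn_integral)
  then have "ennreal_powr ?U p < top" by simp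
  then obtain K where K: "ennreal_powr ?U p = ennreal K" "0 \<le> K"
    by (metis ennreal_cases less_irrefl)
  show thesis
  proof
    fix z :: "int \<Rightarrow> ennreal"
    let ?Z = "\<integral>\<^sup>+m. pow2 (- (\<epsilon> * p / 2 * \<bar>of_int m\<bar>)) * ennreal_powr (z m) p \<partial>count_space UNIV"
    have le: "pow2 (- (\<epsilon> / 2 * \<bar>of_int m\<bar>)) * z m \<le> ennreal_powr ?Z (1 / p)" for m
    proof -
      have "pow2 (- (\<epsilon> * p / 2 * \<bar>of_int m\<bar>)) * ennreal_powr (z m) p \<le> ?Z"
        by (rule nn_integral_ge_point) simp
      then have "ennreal_powr (pow2 (- (\<epsilon> * p / 2 * \<bar>of_int m\<bar>)) * ennreal_powr (z m) p) (1 / p)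
          \<le> ennreal_powr ?Z (1 / p)"
        using assms by (intro ennreal_powr_mono) auto
      then show ?thesis
        using assms by (simp add: ennreal_powr_mult)
    qed
    have "(\<integral>\<^sup>+m. pow2 (- (\<epsilon> * \<bar>of_int m\<bar>)) * z m \<partial>count_space UNIV)
        \<le> (\<integral>\<^sup>+m. pow2 (- (\<epsilon> / 2 * \<bar>of_int m\<bar>)) * ennreal_powr ?Z (1 / p) \<partial>count_space UNIV)"
    proof (rule nn_integral_mono)
      fix m :: int
      have "pow2 (- (\<epsilon> * \<bar>of_int m\<bar>)) = pow2 (- (\<epsilon> / 2 * \<bar>of_int m\<bar>)) * pow2 (- (\<epsilon> / 2 * \<bar>of_int m\<bar>))"
        by (simp flip: pow2_add)
      then show "pow2 (- (\<epsilon> * \<bar>of_int m\<bar>)) * z m \<le> pow2 (- (\<epsilon> / 2 * \<bar>of_int m\<bar>)) * ennreal_powr ?Z (1 / p)"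
        using le[of m] by (simp add: mult.assoc mult_left_mono)
    qed
    also have "\<dots> = ?U * ennreal_powr ?Z (1 / p)"
      by (rule nn_integral_multc) simp
    finally have "ennreal_powr (\<integral>\<^sup>+m. pow2 (- (\<epsilon> * \<bar>of_int m\<bar>)) * z m \<partial>count_space UNIV) p
        \<le> ennreal_powr (?U * ennreal_powr ?Z (1 / p)) p"
      using assms by (intro ennreal_powr_mono) auto
    also have "\<dots> = ennreal K * ?Z"
      using assms K by (simp add: ennreal_powr_mult)
    finally show "ennreal_powr (\<integral>\<^sup>+m. pow2 (- (\<epsilon> * \<bar>of_int m\<bar>)) * z m \<partial>count_space UNIV) p
        \<le> ennreal K * ?Z" .
  qed (rule K)
qed

lemma bij_betw_diff_int: "bij_betw (\<lambda>k. k - m) {..k0} {..k0 - m}" for m :: int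
  by (rule bij_betwI[where g="\<lambda>k. k + m"]) auto

text \<open>\<open>N\<close> plays the role of the p-th power of the Herz-Morrey norm of
  \<open>a\<close>. With m = k - j, the shifted sum up to k0 is a sum up to k0 - m, hence at most
  2^((k0 - m) l p) N. The kernel factor 2^(m l p) restores 2^(k0 l p) N for every m, and the
  remaining decay is summable in m.\<close>

lemma discrete_Herz_Morrey_convolution:
  assumes "0 < \<epsilon>" "0 < p"
  obtains K where "0 \<le> K"
    "\<And>(a :: int \<Rightarrow> ennreal) b N.
      (\<And>k0. (\<Sum>\<^sub>\<infinity>k\<in>{..k0}. pow2 (of_int k * \<alpha> * p) * ennreal_powr (a k) p) \<le> pow2 (of_int k0 * l * p) * N) \<Longrightarrow>
      (\<And>k. b k \<le> (\<Sum>\<^sub>\<infinity>j\<in>UNIV. pow2 (of_int (k - j) * (l - \<alpha>) - \<epsilon> * \<bar>of_int (k - j)\<bar>) * a j)) \<Longrightarrow>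
      (\<And>k0. (\<Sum>\<^sub>\<infinity>k\<in>{..k0}. pow2 (of_int k * \<alpha> * p) * ennreal_powr (b k) p)
        \<le> ennreal K * (pow2 (of_int k0 * l * p) * N))"
proof -
  obtain K where K: "0 \<le> K" "\<And>z :: int \<Rightarrow> ennreal.
      ennreal_powr (\<integral>\<^sup>+m. pow2 (- (\<epsilon> * \<bar>of_int m\<bar>)) * z m \<partial>count_space UNIV) p
        \<le> ennreal K * (\<integral>\<^sup>+m. pow2 (- (\<epsilon> * p / 2 * \<bar>of_int m\<bar>)) * ennreal_powr (z m) p \<partial>count_space UNIV)"
    using powr_weighted_sum_le[OF assms] by blast
  let ?U = "\<integral>\<^sup>+m. pow2 (- (\<epsilon> * p / 2 * \<bar>of_int m\<bar>)) \<partial>count_space (UNIV :: int set)"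
  have "?U < top"
    using infsum_pow2_abs_finite[of "\<epsilon> * p / 2"] assms by (simp add: infsum_ennreal_eq_nn_integral)
  then obtain U where U: "?U = ennreal U" "0 \<le> U"
    by (metis ennreal_cases less_irrefl)
  show thesis
  proof (rule that[of "K * U"])
    fix a b :: "int \<Rightarrow> ennreal" and N :: ennreal and k0 :: int
    assume a: "\<And>k0. (\<Sum>\<^sub>\<infinity>k\<in>{..k0}. pow2 (of_int k * \<alpha> * p) * ennreal_powr (a k) p) \<le> pow2 (of_int k0 * l * p) * N"
      and b: "\<And>k. b k \<le> (\<Sum>\<^sub>\<infinity>j\<in>UNIV. pow2 (of_int (k - j) * (l - \<alpha>) - \<epsilon> * \<bar>of_int (k - j)\<bar>) * a j)"
    define A where "A k = pow2 (of_int k * \<alpha> * p) * ennreal_powr (a k) p" for k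
    have term_le: "pow2 (of_int k * \<alpha> * p) * ennreal_powr (b k) p
        \<le> ennreal K * (\<integral>\<^sup>+m. pow2 (- (\<epsilon> * p / 2 * \<bar>of_int m\<bar>)) * (pow2 (of_int m * l * p) * A (k - m)) \<partial>count_space UNIV)" for k
    proof -
      \<comment> \<open>Here 2^(k \<alpha>) is split at m: the part 2^(m \<alpha>) cancels the
        \<alpha> in the kernel, and 2^((k - m) \<alpha>) is the Herz weight belonging to
        \<open>a (k - m)\<close>.\<close>
      let ?z = "\<lambda>m. pow2 (of_int m * l + of_int (k - m) * \<alpha>) * a (k - m)"
      have "pow2 (of_int k * \<alpha>) * b k
          \<le> pow2 (of_int k * \<alpha>) * (\<integral>\<^sup>+j. pow2 (of_int (k - j) * (l - \<alpha>) - \<epsilon> * \<bar>of_int (k - j)\<bar>) * a j \<partial>count_space UNIV)"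
        using b[of k] by (simp add: infsum_ennreal_eq_nn_integral mult_left_mono)
      also have "(\<integral>\<^sup>+j. pow2 (of_int (k - j) * (l - \<alpha>) - \<epsilon> * \<bar>of_int (k - j)\<bar>) * a j \<partial>count_space UNIV)
          = (\<integral>\<^sup>+m. pow2 (of_int m * (l - \<alpha>) - \<epsilon> * \<bar>of_int m\<bar>) * a (k - m) \<partial>count_space UNIV)"
      proof -
        have "bij (\<lambda>m. k - m)"
          by (rule bij_betwI[where g="\<lambda>m. k - m"]) auto
        from nn_integral_bij_count_space[OF this, of "\<lambda>j. pow2 (of_int (k - j) * (l - \<alpha>) - \<epsilon> * \<bar>of_int (k - j)\<bar>) * a j"]
        show ?thesis by simp
      qed
      also have "pow2 (of_int k * \<alpha>) * \<dots> = (\<integral>\<^sup>+m. pow2 (- (\<epsilon> * \<bar>of_int m\<bar>)) * ?z m \<partial>count_space UNIV)"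
      proof -
        have "of_int k * \<alpha> + (of_int m * (l - \<alpha>) - \<epsilon> * \<bar>of_int m\<bar>)
            = - (\<epsilon> * \<bar>of_int m\<bar>) + (of_int m * l + of_int (k - m) * \<alpha>)" for m
          by (simp add: algebra_simps)
        then have "pow2 (of_int k * \<alpha>) * (pow2 (of_int m * (l - \<alpha>) - \<epsilon> * \<bar>of_int m\<bar>) * a (k - m))
            = pow2 (- (\<epsilon> * \<bar>of_int m\<bar>)) * ?z m" for m
          by (metis mult.assoc pow2_add)
        then show ?thesis
          by (simp add: nn_integral_cmult[symmetric])
      qed
      finally have "ennreal_powr (pow2 (of_int k * \<alpha>) * b k) p
          \<le> ennreal_powr (\<integral>\<^sup>+m. pow2 (- (\<epsilon> * \<bar>of_int m\<bar>)) * ?z m \<partial>count_space UNIV) p"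
        using assms by (intro ennreal_powr_mono) auto
      also have "\<dots> \<le> ennreal K * (\<integral>\<^sup>+m. pow2 (- (\<epsilon> * p / 2 * \<bar>of_int m\<bar>)) * ennreal_powr (?z m) p \<partial>count_space UNIV)"
        by (rule K)
      also have "(\<lambda>m. ennreal_powr (?z m) p) = (\<lambda>m. pow2 (of_int m * l * p) * A (k - m))"
        using assms by (simp add: A_def ennreal_powr_mult distrib_right pow2_add mult.assoc)
      finally show ?thesis
        using assms by (simp add: ennreal_powr_mult)
    qed
    have "(\<Sum>\<^sub>\<infinity>k\<in>{..k0}. pow2 (of_int k * \<alpha> * p) * ennreal_powr (b k) p)
        \<le> (\<integral>\<^sup>+k. ennreal K * (\<integral>\<^sup>+m. pow2 (- (\<epsilon> * p / 2 * \<bar>of_int m\<bar>)) * (pow2 (of_int m * l * p) * A (k - m)) \<partial>count_space UNIV) \<partial>count_space {..k0})"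
      unfolding infsum_ennreal_eq_nn_integral by (intro nn_integral_mono term_le)
    also have "\<dots> = ennreal K * (\<integral>\<^sup>+m. (\<integral>\<^sup>+k. pow2 (- (\<epsilon> * p / 2 * \<bar>of_int m\<bar>)) * (pow2 (of_int m * l * p) * A (k - m)) \<partial>count_space {..k0}) \<partial>count_space UNIV)"
      by (subst nn_integral_cmult, simp, subst nn_integral_count_space_nn_integral) auto
    also have "\<dots> \<le> ennreal K * (\<integral>\<^sup>+m. pow2 (- (\<epsilon> * p / 2 * \<bar>of_int m\<bar>)) * (pow2 (of_int k0 * l * p) * N) \<partial>count_space UNIV)"
    proof (intro mult_left_mono nn_integral_mono)
      fix m :: int
      have "(\<integral>\<^sup>+k. pow2 (- (\<epsilon> * p / 2 * \<bar>of_int m\<bar>)) * (pow2 (of_int m * l * p) * A (k - m)) \<partial>count_space {..k0})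
          = pow2 (- (\<epsilon> * p / 2 * \<bar>of_int m\<bar>)) * (pow2 (of_int m * l * p) * (\<integral>\<^sup>+k. A (k - m) \<partial>count_space {..k0}))"
        by (simp add: nn_integral_cmult)
      also have "(\<integral>\<^sup>+k. A (k - m) \<partial>count_space {..k0}) = (\<integral>\<^sup>+k. A k \<partial>count_space {..k0 - m})"
        by (rule nn_integral_bij_count_space[OF bij_betw_diff_int])
      also have "\<dots> \<le> pow2 (of_int (k0 - m) * l * p) * N"
        using a[of "k0 - m"] by (simp add: A_def infsum_ennreal_eq_nn_integral)
      also have "pow2 (of_int m * l * p) * (pow2 (of_int (k0 - m) * l * p) * N) = pow2 (of_int k0 * l * p) * N"
      proof -
        have "of_int m * l * p + of_int (k0 - m) * l * p = of_int k0 * l * p"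
          by (simp add: algebra_simps)
        then show ?thesis
          by (metis mult.assoc pow2_add)
      qed
      finally show "(\<integral>\<^sup>+k. pow2 (- (\<epsilon> * p / 2 * \<bar>of_int m\<bar>)) * (pow2 (of_int m * l * p) * A (k - m)) \<partial>count_space {..k0})
          \<le> pow2 (- (\<epsilon> * p / 2 * \<bar>of_int m\<bar>)) * (pow2 (of_int k0 * l * p) * N)"
        by (simp add: mult_left_mono)
    qed auto
    also have "\<dots> = ennreal (K * U) * (pow2 (of_int k0 * l * p) * N)"
      using K(1) U by (simp add: nn_integral_multc ennreal_mult' mult.assoc)
    finally show "(\<Sum>\<^sub>\<infinity>k\<in>{..k0}. pow2 (of_int k * \<alpha> * p) * ennreal_powr (b k) p)
        \<le> ennreal (K * U) * (pow2 (of_int k0 * l * p) * N)" .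
  qed (use K U in auto)
qed

section \<open>Dyadic annuli\<close>

lemma two_powi_eq_powr: "(2::real) powi k = 2 powr of_int k"
  by (simp add: powr_real_of_int')

lemma mem_annulus: "x \<in> annulus k \<longleftrightarrow> 2 powr of_int (k - 1) < norm x \<and> norm x \<le> 2 powr of_int k"
  by (auto simp: annulus_def dyadic_ball_def two_powi_eq_powr)

text \<open>Annuli are open at the inner and closed at the outer radius, hence the ceiling. Both
  disjointness and the covering of all nonzero points are read off from this formula.\<close>

lemma mem_annulus_iff_ceiling: "x \<in> annulus k \<longleftrightarrow> x \<noteq> 0 \<and> k = \<lceil>log 2 (norm x)\<rceil>"
proof (cases "x = 0")
  case False
  then show ?thesis
    by (auto simp: mem_annulus ceiling_eq_iff less_log_iff log_le_iff eq_commute[of k])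
qed (auto simp: mem_annulus not_less)

lemma annulus_disjoint: "j \<noteq> k \<Longrightarrow> annulus j \<inter> annulus k = {}"
  by (auto simp: mem_annulus_iff_ceiling)

lemma annulus_borel [measurable]: "annulus k \<in> sets borel"
proof -
  have "closed (dyadic_ball k)" for k
    unfolding dyadic_ball_def by (intro closed_Collect_le continuous_intros)
  then show ?thesis
    unfolding annulus_def by (intro sets.Diff) (auto intro: borel_closed)
qed

lemma annulus_coord_le: "x \<in> annulus k \<Longrightarrow> \<bar>x $ j\<bar> \<le> 2 powr of_int k"
  using component_le_norm_cart[of x j] by (auto simp: mem_annulus)

lemma annulus_subset_compact:
  obtains K where "compact K" "K \<subseteq> UNIV - {0}" "annulus k \<subseteq> K"
proof
  show "compact (cball 0 (2 powr of_int k) - ball 0 (2 powr of_int (k - 1)) :: (real^'n) set)"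
    by (intro compact_diff) auto
qed (auto simp: mem_annulus)

text \<open>On a nonempty compact set that avoids the origin the norm attains a positive minimum and
  a maximum, and the index of the annulus is monotone in the norm.\<close>

lemma compact_subset_finite_annuli:
  assumes "compact K" "K \<subseteq> UNIV - {0}"
  obtains S where "finite S" "K \<subseteq> (\<Union>k\<in>S. annulus k)"
proof (cases "K = {}")
  case False
  obtain a where a: "a \<in> K" "\<And>x. x \<in> K \<Longrightarrow> norm a \<le> norm x"
    using continuous_attains_inf[OF assms(1) False continuous_on_norm_id] by auto
  obtain b where b: "b \<in> K" "\<And>x. x \<in> K \<Longrightarrow> norm x \<le> norm b"
    using continuous_attains_sup[OF assms(1) False continuous_on_norm_id] by auto
  show thesis
  proof (rule that[of "{\<lceil>log 2 (norm a)\<rceil>..\<lceil>log 2 (norm b)\<rceil>}"])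
    show "K \<subseteq> (\<Union>k\<in>{\<lceil>log 2 (norm a)\<rceil>..\<lceil>log 2 (norm b)\<rceil>}. annulus k)"
    proof
      fix x assume x: "x \<in> K"
      then have "0 < norm a" "0 < norm x" "0 < norm b" "x \<noteq> 0"
        using assms(2) a(1) b(1) by auto
      then have "\<lceil>log 2 (norm x)\<rceil> \<in> {\<lceil>log 2 (norm a)\<rceil>..\<lceil>log 2 (norm b)\<rceil>}"
        using a(2)[OF x] b(2)[OF x] by (auto intro!: ceiling_mono)
      moreover have "x \<in> annulus \<lceil>log 2 (norm x)\<rceil>"
        using \<open>x \<noteq> 0\<close> by (simp add: mem_annulus_iff_ceiling)
      ultimately show "x \<in> (\<Union>k\<in>{\<lceil>log 2 (norm a)\<rceil>..\<lceil>log 2 (norm b)\<rceil>}. annulus k)"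
        by blast
    qed
  qed simp
qed (use that[of "{}"] in auto)

section \<open>Restrictions and the sequence form of the Herz-Morrey norm\<close>

lemma ennreal_norm_restr: "ennreal (norm (restr S f x)) = indicator S x * ennreal (norm (f x))"
  by (simp add: restr_def indicator_def)

lemma restr_borel_measurable:
  fixes f :: "real^'n \<Rightarrow> 'a::euclidean_space"
  assumes [measurable]: "S \<in> sets lebesgue" "f \<in> borel_measurable lebesgue"
  shows "restr S f \<in> borel_measurable lebesgue"
  unfolding restr_def by measurable

lemma borel_in_lebesgue: "S \<in> sets borel \<Longrightarrow> S \<in> sets lebesgue"
  by (simp add: sets_completionI_sets)

lemma restr_Un: "A \<inter> B = {} \<Longrightarrow> restr (A \<union> B) f = (\<lambda>x. restr A f x + restr B f x)"
  by (auto simp: restr_def fun_eq_iff indicator_def max_def)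

text \<open>The Herz-Morrey norm sees a function only through the norms \<open>a k\<close> of its
  annular pieces, so the convolution estimate can be stated for sequences.\<close>

definition herz_seq :: "real \<Rightarrow> real \<Rightarrow> real \<Rightarrow> (int \<Rightarrow> ennreal) \<Rightarrow> ennreal" where
  "herz_seq \<alpha> l p a = (SUP k0::int. pow2 (- of_int k0 * l) *
     ennreal_powr (\<Sum>\<^sub>\<infinity>k\<in>{..k0}. pow2 (of_int k * \<alpha> * p) * ennreal_powr (a k) p) (1 / p))"

lemma herz_morrey_norm_eq_herz_seq:
  "herz_morrey_norm \<alpha> l p q f = herz_seq \<alpha> l p (\<lambda>k. mixed_norm q (restr (annulus k) f))"
  by (simp add: herz_morrey_norm_def herz_seq_def pow2_def)

lemma herz_seq_finite_imp:
  assumes "0 < p" "herz_seq \<alpha> l p a < top"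
  shows "a k < top"
proof (rule ccontr)
  assume "\<not> a k < top"
  then have "a k = top" by (simp add: not_less top_unique)
  then have "top \<le> (\<Sum>\<^sub>\<infinity>k\<in>{..k}. pow2 (of_int k * \<alpha> * p) * ennreal_powr (a k) p)"
    unfolding infsum_ennreal_eq_nn_integral
    by (intro order_trans[OF _ nn_integral_ge_point[of k]]) (auto simp: ennreal_mult_top)
  then have "pow2 (- of_int k * l) *
     ennreal_powr (\<Sum>\<^sub>\<infinity>k\<in>{..k}. pow2 (of_int k * \<alpha> * p) * ennreal_powr (a k) p) (1 / p) = top"
    by (simp add: top_unique ennreal_mult_top)
  then have "top \<le> herz_seq \<alpha> l p a"
    unfolding herz_seq_def by (intro SUP_upper2[of k]) auto
  with assms(2) show False
    by (simp add: top_unique)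
qed

lemma herz_seq_convolution_le:
  assumes "0 < \<epsilon>" "0 < p" "0 \<le> C"
  obtains C' where "0 \<le> C'"
    "\<And>a b. (\<And>k. b k \<le> (\<Sum>\<^sub>\<infinity>j\<in>UNIV. ennreal C * (pow2 (of_int (k - j) * (l - \<alpha>) - \<epsilon> * \<bar>of_int (k - j)\<bar>) * a j)))
      \<Longrightarrow> herz_seq \<alpha> l p b \<le> ennreal C' * herz_seq \<alpha> l p a"
proof -
  obtain K where K: "0 \<le> K"
    "\<And>(a :: int \<Rightarrow> ennreal) b N k0.
      (\<And>k0. (\<Sum>\<^sub>\<infinity>k\<in>{..k0}. pow2 (of_int k * \<alpha> * p) * ennreal_powr (a k) p) \<le> pow2 (of_int k0 * l * p) * N) \<Longrightarrow>
      (\<And>k. b k \<le> (\<Sum>\<^sub>\<infinity>j\<in>UNIV. pow2 (of_int (k - j) * (l - \<alpha>) - \<epsilon> * \<bar>of_int (k - j)\<bar>) * a j)) \<Longrightarrow>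
      (\<Sum>\<^sub>\<infinity>k\<in>{..k0}. pow2 (of_int k * \<alpha> * p) * ennreal_powr (b k) p)
        \<le> ennreal K * (pow2 (of_int k0 * l * p) * N)"
    using discrete_Herz_Morrey_convolution[OF assms(1,2), of \<alpha> l] by blast
  show thesis
  proof (rule that[of "K powr (1 / p) * C"])
    fix a b :: "int \<Rightarrow> ennreal"
    assume b: "\<And>k. b k \<le> (\<Sum>\<^sub>\<infinity>j\<in>UNIV. ennreal C * (pow2 (of_int (k - j) * (l - \<alpha>) - \<epsilon> * \<bar>of_int (k - j)\<bar>) * a j))"
    let ?H = "herz_seq \<alpha> l p a"
    \<comment> \<open>\<open>C\<close> is absorbed into the sequence \<open>a\<close>, and the p-th
      power matches the sums without root in the convolution lemma.\<close>
    let ?N = "ennreal_powr (ennreal C * ?H) p"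
    \<comment> \<open>The Morrey weights are invertible, so they can be moved across an inequality
      even if the norm is infinite.\<close>
    have inv: "pow2 (of_int k0 * l) * pow2 (- of_int k0 * l) = 1"
        "pow2 (- of_int k0 * l) * pow2 (of_int k0 * l) = 1" for k0 :: int
      by (simp_all flip: pow2_add)
    have shift: "pow2 (of_int k0 * l) * (pow2 (- of_int k0 * l) * t) = t"
        "pow2 (- of_int k0 * l) * (pow2 (of_int k0 * l) * t) = t" for k0 :: int and t
      by (simp_all only: mult.assoc[symmetric] inv mult_1)
    have "(\<Sum>\<^sub>\<infinity>k\<in>{..k0}. pow2 (of_int k * \<alpha> * p) * ennreal_powr (ennreal C * a k) p)
        \<le> pow2 (of_int k0 * l * p) * ?N" for k0
    proof -
      let ?S = "\<Sum>\<^sub>\<infinity>k\<in>{..k0}. pow2 (of_int k * \<alpha> * p) * ennreal_powr (a k) p"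
      have "pow2 (- of_int k0 * l) * ennreal_powr ?S (1 / p) \<le> ?H"
        unfolding herz_seq_def by (rule SUP_upper) simp
      then have "ennreal_powr ?S (1 / p) \<le> pow2 (of_int k0 * l) * ?H"
        using mult_left_mono[of "pow2 (- of_int k0 * l) * ennreal_powr ?S (1 / p)" ?H "pow2 (of_int k0 * l)"]
        unfolding shift by simp
      then have "ennreal_powr (ennreal_powr ?S (1 / p)) p \<le> ennreal_powr (pow2 (of_int k0 * l) * ?H) p"
        using assms by (intro ennreal_powr_mono) auto
      then have S: "?S \<le> pow2 (of_int k0 * l * p) * ennreal_powr ?H p"
        using assms by (simp add: ennreal_powr_mult)
      have "(\<Sum>\<^sub>\<infinity>k\<in>{..k0}. pow2 (of_int k * \<alpha> * p) * ennreal_powr (ennreal C * a k) p)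
          = ennreal_powr (ennreal C) p * ?S"
        unfolding infsum_ennreal_eq_nn_integral using assms
        by (subst nn_integral_cmult[symmetric]) (auto simp: ennreal_powr_mult mult_ac intro!: nn_integral_cong)
      also have "\<dots> \<le> ennreal_powr (ennreal C) p * (pow2 (of_int k0 * l * p) * ennreal_powr ?H p)"
        by (rule mult_left_mono[OF S]) simp
      finally show ?thesis
        using assms by (simp only: ennreal_powr_mult mult_ac)
    qed
    note S_le = K(2)[OF this, of b]
    show "herz_seq \<alpha> l p b \<le> ennreal (K powr (1 / p) * C) * ?H"
      unfolding herz_seq_def[of _ _ _ b]
    proof (rule SUP_least)
      fix k0 :: int
      let ?S = "\<Sum>\<^sub>\<infinity>k\<in>{..k0}. pow2 (of_int k * \<alpha> * p) * ennreal_powr (b k) p"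
      have "?S \<le> ennreal K * (pow2 (of_int k0 * l * p) * ?N)"
        using b by (intro S_le) (simp add: mult_ac)
      then have "ennreal_powr ?S (1 / p) \<le> ennreal_powr (ennreal K * (pow2 (of_int k0 * l * p) * ?N)) (1 / p)"
        using assms by (intro ennreal_powr_mono) auto
      also have "\<dots> = pow2 (of_int k0 * l) * (ennreal (K powr (1 / p) * C) * ?H)"
        using assms K(1) by (simp add: ennreal_powr_mult ennreal_mult' powr_powr mult_ac)
      finally have "pow2 (- of_int k0 * l) * ennreal_powr ?S (1 / p)
          \<le> pow2 (- of_int k0 * l) * (pow2 (of_int k0 * l) * (ennreal (K powr (1 / p) * C) * ?H))"
        by (rule mult_left_mono) simp
      also have "\<dots> = ennreal (K powr (1 / p) * C) * ?H"
        by (rule shift)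
      finally show "pow2 (- of_int k0 * l) * ennreal_powr ?S (1 / p) \<le> ennreal (K powr (1 / p) * C) * ?H" .
    qed
  qed (use assms in simp)
qed

section \<open>Norms of annular pieces\<close>

context
  fixes q :: "real^'n::{finite,linorder}"
  assumes q: "\<And>i. 1 \<le> q $ i"
begin

lemma q_gt_0: "0 < q $ i"
  using q[of i] by simp

lemma mixed_norm_restr:
  "mixed_norm q (restr S f) = total_norm q (\<lambda>x. indicator S x * ennreal (norm (f x)))"
  by (simp add: mixed_norm_eq_total_norm[OF q_gt_0] ennreal_norm_restr)

lemma mixed_norm_restr_le: "mixed_norm q (restr S f) \<le> mixed_norm q f"
  unfolding mixed_norm_restr unfolding mixed_norm_eq_total_norm[OF q_gt_0]
  by (rule total_norm_mono[OF q]) (simp add: indicator_def)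

lemma restr_mixed_Lebesgue:
  fixes f :: "real^'n::{finite,linorder} \<Rightarrow> 'a::euclidean_space"
  assumes "S \<in> sets borel" "f \<in> mixed_Lebesgue q"
  shows "restr S f \<in> mixed_Lebesgue q"
  using assms le_less_trans[OF mixed_norm_restr_le[of S f]]
  by (auto simp: mixed_Lebesgue_def intro!: restr_borel_measurable borel_in_lebesgue)

lemma restr_annulus_mixed_Lebesgue:
  fixes f :: "real^'n::{finite,linorder} \<Rightarrow> 'a::euclidean_space"
  assumes "f \<in> mixed_Lebesgue_loc q"
  shows "restr (annulus k) f \<in> mixed_Lebesgue q"
proof -
  obtain K :: "(real^'n::{finite,linorder}) set" where K: "compact K" "K \<subseteq> UNIV - {0}" "annulus k \<subseteq> K"
    by (rule annulus_subset_compact)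
  then have "restr K f \<in> mixed_Lebesgue q"
    using assms by (auto simp: mixed_Lebesgue_loc_def)
  then have "restr (annulus k) (restr K f) \<in> mixed_Lebesgue q"
    by (rule restr_mixed_Lebesgue[rotated]) simp
  moreover have "restr (annulus k) (restr K f) = restr (annulus k) f"
    using K(3) by (auto simp: restr_def indicator_def fun_eq_iff)
  ultimately show ?thesis by simp
qed

text \<open>The annulus lies in a cube of side 2^(k+1), which explains the shift
  \<open>k + 1\<close> in the exponent.\<close>

lemma mixed_norm_restr_annulus_le:
  assumes "AE x in lebesgue. x \<in> annulus k \<longrightarrow> norm (g x) \<le> c"
  shows "mixed_norm q (restr (annulus k) g)
    \<le> pow2 ((of_int k + 1) * (\<Sum>i\<in>UNIV. 1 / q $ i)) * ennreal c"
proof -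
  have "total_norm q (\<lambda>x. indicator (annulus k) x * ennreal (norm (g x)))
      \<le> ennreal ((2 * 2 powr of_int k) powr (\<Sum>i\<in>UNIV. 1 / q $ i)) * ennreal c"
  proof (rule total_norm_le_const[OF q])
    show "AE x in lebesgue. indicator (annulus k) x * ennreal (norm (g x)) \<le> ennreal c"
      using assms by eventually_elim (auto simp: indicator_def intro: ennreal_leI)
    show "indicator (annulus k) x * ennreal (norm (g x)) = 0" if "2 powr of_int k < \<bar>x $ j\<bar>" for x j
      using annulus_coord_le[of x k j] that by (auto simp: indicator_def)
  qed simp
  also have "2 * 2 powr of_int k = (2::real) powr (of_int k + 1)"
    by (simp add: powr_add)
  finally show ?thesis
    by (simp add: mixed_norm_restr pow2_def powr_powr)
qed

text \<open>Hoelder's inequality on the cube of side 2^(k+1) around the annulus; the exponents 1 -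
  1/q_i add up to n - s. The same bound yields integrability.\<close>

lemma restr_annulus_L1:
  fixes f :: "real^'n::{finite,linorder} \<Rightarrow> 'a::euclidean_space"
  assumes "restr (annulus k) f \<in> mixed_Lebesgue q"
  shows "restr (annulus k) f \<in> L1_on_annulus k"
    and "ennreal (\<integral>x. norm (restr (annulus k) f x) \<partial>lebesgue)
      \<le> pow2 ((of_int k + 1) * (real CARD('n) - (\<Sum>i\<in>UNIV. 1 / q $ i))) * mixed_norm q (restr (annulus k) f)"
proof -
  let ?f = "restr (annulus k) f"
  have meas [measurable]: "?f \<in> borel_measurable lebesgue" and fin: "mixed_norm q ?f < top"
    using assms by (auto simp: mixed_Lebesgue_def)
  have "(\<integral>\<^sup>+x. ennreal (norm (?f x)) \<partial>lebesgue)
      \<le> ennreal ((2 * 2 powr of_int k) powr (\<Sum>i\<in>UNIV. 1 - 1 / q $ i)) * total_norm q (\<lambda>x. ennreal (norm (?f x)))"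
  proof (rule nn_integral_le_total_norm[OF q])
    show "ennreal (norm (?f x)) = 0" if "2 powr of_int k < \<bar>x $ j\<bar>" for x j
      using annulus_coord_le[of x k j] that by (auto simp: indicator_def restr_def)
  qed auto
  also have "2 * 2 powr of_int k = (2::real) powr (of_int k + 1)"
    by (simp add: powr_add)
  finally have le: "(\<integral>\<^sup>+x. ennreal (norm (?f x)) \<partial>lebesgue)
      \<le> pow2 ((of_int k + 1) * (real CARD('n) - (\<Sum>i\<in>UNIV. 1 / q $ i))) * mixed_norm q ?f"
    by (simp add: mixed_norm_eq_total_norm[OF q_gt_0] pow2_def powr_powr sum_subtractf)
  also have "\<dots> < top"
    using fin by (simp add: ennreal_mult_less_top)
  finally have int: "integrable lebesgue ?f"
    by (intro integrableI_bounded) auto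
  then show "?f \<in> L1_on_annulus k"
    by (auto simp: L1_on_annulus_def restr_def)
  show "ennreal (\<integral>x. norm (?f x) \<partial>lebesgue)
      \<le> pow2 ((of_int k + 1) * (real CARD('n) - (\<Sum>i\<in>UNIV. 1 / q $ i))) * mixed_norm q ?f"
    using le nn_integral_eq_integral[OF integrable_norm[OF int]] by simp
qed

lemma mixed_norm_restr_UN_le:
  fixes g :: "real^'n::{finite,linorder} \<Rightarrow> 'a::euclidean_space"
  assumes "finite S" "K \<subseteq> (\<Union>k\<in>S. annulus k)" and [measurable]: "g \<in> borel_measurable lebesgue"
  shows "mixed_norm q (restr K g) \<le> (\<Sum>k\<in>S. mixed_norm q (restr (annulus k) g))"
proof -
  have "mixed_norm q (restr K g) \<le> total_norm q (\<lambda>x. \<Sum>k\<in>S. indicator (annulus k) x * ennreal (norm (g x)))"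
    unfolding mixed_norm_restr
  proof (rule total_norm_mono[OF q])
    fix x
    show "indicator K x * ennreal (norm (g x)) \<le> (\<Sum>k\<in>S. indicator (annulus k) x * ennreal (norm (g x)))"
    proof (cases "x \<in> K")
      case True
      then obtain k where k: "k \<in> S" "x \<in> annulus k"
        using assms(2) by auto
      then have "indicator K x * ennreal (norm (g x)) \<le> indicator (annulus k) x * ennreal (norm (g x))"
        using True by simp
      also have "\<dots> \<le> (\<Sum>k\<in>S. indicator (annulus k) x * ennreal (norm (g x)))"
        using assms(1) k(1) by (intro member_le_sum) auto
      finally show ?thesis .
    qed simp
  qed
  also have "\<dots> \<le> (\<Sum>k\<in>S. mixed_norm q (restr (annulus k) g))"
    unfolding mixed_norm_restr using assms(1)
    by (intro total_norm_sum[OF q]) (auto intro!: borel_measurable_times_ennreal borel_measurable_indicator borel_in_lebesgue)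
  finally show ?thesis .
qed

end

section \<open>Boundedness on Herz-Morrey spaces\<close>

text \<open>On annulus k the decay |x|^(-n) is at most 2^(-(k-1)n). Together with 2^((k+1)s) from
  the norm of the indicator and 2^((j+1)(n-s)) from Hoelder this gives the exponent (j-k)(n-s) +
  2n.\<close>

lemma mixed_norm_outer_annulus_le:
  fixes q :: "real^'n::{finite,linorder}"
    and f g :: "real^'n::{finite,linorder} \<Rightarrow> 'a::euclidean_space"
  assumes q: "\<And>i. 1 \<le> q $ i" and "0 \<le> C" and f: "restr (annulus j) f \<in> mixed_Lebesgue q"
    and g: "AE x in lebesgue. norm x \<ge> 2 powi (j + 1) \<longrightarrow>
      norm (g x) \<le> C * (\<integral>y. norm (restr (annulus j) f y) \<partial>lebesgue) * norm x powi (- int CARD('n))"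
    and "j + 2 \<le> k"
  shows "mixed_norm q (restr (annulus k) g) \<le> ennreal C *
    (pow2 (of_int (j - k) * (real CARD('n) - (\<Sum>i\<in>UNIV. 1 / q $ i)) + 2 * real CARD('n))
      * mixed_norm q (restr (annulus j) f))"
proof -
  define n where "n = real CARD('n)"
  define s where "s = (\<Sum>i\<in>UNIV. 1 / q $ i)"
  define I where "I = (\<integral>y. norm (restr (annulus j) f y) \<partial>lebesgue)"
  have "0 \<le> I" by (simp add: I_def)
  have I: "ennreal I \<le> pow2 ((of_int j + 1) * (n - s)) * mixed_norm q (restr (annulus j) f)"
    unfolding I_def n_def s_def by (rule restr_annulus_L1[OF q f])
  have "AE x in lebesgue. x \<in> annulus k \<longrightarrow> norm (g x) \<le> C * I * 2 powr (- (of_int k - 1) * n)"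
    using g
  proof eventually_elim
    case (elim x)
    show ?case
    proof
      assume "x \<in> annulus k"
      then have x: "2 powr (of_int k - 1) < norm x"
        by (simp add: mem_annulus)
      \<comment> \<open>The inner radius 2^(k-1) reaches 2^(j+1) precisely when j + 2 \<le> k, so
        the size condition covers the whole annulus.\<close>
      have "(2::real) powr of_int (j + 1) \<le> 2 powr (of_int k - 1)"
        using \<open>j + 2 \<le> k\<close> by simp
      then have "norm x \<ge> 2 powi (j + 1)"
        using x unfolding two_powi_eq_powr by linarith
      with elim have "norm (g x) \<le> C * I * norm x powi (- int CARD('n))"
        by (simp add: I_def)
      also have "norm x powi (- int CARD('n)) = norm x powr (- n)"
        using powr_real_of_int'[of "norm x" "- int CARD('n)"] x by (force simp: n_def)
      also have "norm x powr (- n) \<le> (2 powr (of_int k - 1)) powr (- n)"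
        using x by (intro powr_mono2') (auto simp: n_def)
      also have "\<dots> = 2 powr (- (of_int k - 1) * n)"
        by (simp add: powr_powr algebra_simps)
      finally show "norm (g x) \<le> C * I * 2 powr (- (of_int k - 1) * n)"
        using \<open>0 \<le> C\<close> \<open>0 \<le> I\<close> by (simp add: mult_left_mono)
    qed
  qed
  from mixed_norm_restr_annulus_le[OF q this]
  have "mixed_norm q (restr (annulus k) g)
      \<le> pow2 ((of_int k + 1) * s) * ennreal (C * I * 2 powr (- (of_int k - 1) * n))"
    by (simp add: s_def)
  also have "\<dots> = ennreal C * (pow2 ((of_int k + 1) * s + - (of_int k - 1) * n) * ennreal I)"
    unfolding pow2_add using \<open>0 \<le> C\<close> \<open>0 \<le> I\<close> by (simp add: pow2_def ennreal_mult' mult_ac)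
  also have "\<dots> \<le> ennreal C * (pow2 ((of_int k + 1) * s + - (of_int k - 1) * n)
      * (pow2 ((of_int j + 1) * (n - s)) * mixed_norm q (restr (annulus j) f)))"
    by (intro mult_left_mono I) auto
  also have "\<dots> = ennreal C * (pow2 ((of_int k + 1) * s + - (of_int k - 1) * n + (of_int j + 1) * (n - s))
      * mixed_norm q (restr (annulus j) f))"
    by (simp only: pow2_add mult.assoc)
  also have "(of_int k + 1) * s + - (of_int k - 1) * n + (of_int j + 1) * (n - s)
      = of_int (j - k) * (n - s) + 2 * n"
    by (simp add: algebra_simps)
  finally show ?thesis
    by (simp add: n_def s_def)
qed

text \<open>The size condition gives the constant 2^(-nj) on annulus k; with 2^((k+1)s) and
  2^((j+1)(n-s)) the powers of 2^(nj) cancel, and (k-j)s + n remains.\<close>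

lemma mixed_norm_inner_annulus_le:
  fixes q :: "real^'n::{finite,linorder}"
    and f g :: "real^'n::{finite,linorder} \<Rightarrow> 'a::euclidean_space"
  assumes q: "\<And>i. 1 \<le> q $ i" and "0 \<le> C" and f: "restr (annulus j) f \<in> mixed_Lebesgue q"
    and g: "AE x in lebesgue. norm x \<le> 2 powi (j - 2) \<longrightarrow>
      norm (g x) \<le> C * (\<integral>y. norm (restr (annulus j) f y) \<partial>lebesgue) * 2 powi (- int CARD('n) * j)"
    and "k + 2 \<le> j"
  shows "mixed_norm q (restr (annulus k) g) \<le> ennreal C *
    (pow2 (of_int (k - j) * (\<Sum>i\<in>UNIV. 1 / q $ i) + real CARD('n)) * mixed_norm q (restr (annulus j) f))"
proof -
  define n where "n = real CARD('n)"
  define s where "s = (\<Sum>i\<in>UNIV. 1 / q $ i)"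
  define I where "I = (\<integral>y. norm (restr (annulus j) f y) \<partial>lebesgue)"
  have "0 \<le> I" by (simp add: I_def)
  have I: "ennreal I \<le> pow2 ((of_int j + 1) * (n - s)) * mixed_norm q (restr (annulus j) f)"
    unfolding I_def n_def s_def by (rule restr_annulus_L1[OF q f])
  have "AE x in lebesgue. x \<in> annulus k \<longrightarrow> norm (g x) \<le> C * I * 2 powr (- n * of_int j)"
    using g
  proof eventually_elim
    case (elim x)
    show ?case
    proof
      assume "x \<in> annulus k"
      then have "norm x \<le> 2 powr of_int k"
        by (simp add: mem_annulus)
      also have "(2::real) powr of_int k \<le> 2 powi (j - 2)"
        using \<open>k + 2 \<le> j\<close> by (simp add: two_powi_eq_powr)
      finally show "norm (g x) \<le> C * I * 2 powr (- n * of_int j)"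
        using elim by (simp add: I_def n_def two_powi_eq_powr)
    qed
  qed
  from mixed_norm_restr_annulus_le[OF q this]
  have "mixed_norm q (restr (annulus k) g)
      \<le> pow2 ((of_int k + 1) * s) * ennreal (C * I * 2 powr (- n * of_int j))"
    by (simp add: s_def)
  also have "\<dots> = ennreal C * (pow2 ((of_int k + 1) * s + - n * of_int j) * ennreal I)"
    unfolding pow2_add using \<open>0 \<le> C\<close> \<open>0 \<le> I\<close> by (simp add: pow2_def ennreal_mult' mult_ac)
  also have "\<dots> \<le> ennreal C * (pow2 ((of_int k + 1) * s + - n * of_int j)
      * (pow2 ((of_int j + 1) * (n - s)) * mixed_norm q (restr (annulus j) f)))"
    by (intro mult_left_mono I) auto
  also have "\<dots> = ennreal C * (pow2 ((of_int k + 1) * s + - n * of_int j + (of_int j + 1) * (n - s))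
      * mixed_norm q (restr (annulus j) f))"
    by (simp only: pow2_add mult.assoc)
  also have "(of_int k + 1) * s + - n * of_int j + (of_int j + 1) * (n - s) = of_int (k - j) * s + n"
    by (simp add: algebra_simps)
  finally show ?thesis
    by (simp add: n_def s_def)
qed

text \<open>One annulus at a time is peeled off the remainder. Subadditivity is available only if
  both summands and their sum lie in \<open>D\<close>; here all three are restrictions of
  \<open>f\<close> to Borel sets and so lie in the mixed Lebesgue space.\<close>

lemma sublinear_annular_decomposition:
  fixes q :: "real^'n::{finite,linorder}"
    and T :: "(real^'n::{finite,linorder} \<Rightarrow> 'a::{real_normed_field,euclidean_space}) \<Rightarrow> (real^'n::{finite,linorder} \<Rightarrow> 'a)"
  assumes q: "\<And>i. 1 \<le> q $ i" and D: "mixed_Lebesgue q \<subseteq> D" and T: "sublinear_operator D T"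
    and f: "f \<in> mixed_Lebesgue q" and "finite S"
  shows "AE x in lebesgue. norm (T f x)
    \<le> (\<Sum>j\<in>S. norm (T (restr (annulus j) f) x)) + norm (T (restr (- (\<Union>j\<in>S. annulus j)) f) x)"
  using \<open>finite S\<close>
proof (induction S rule: finite_induct)
  case empty
  have "restr UNIV f = f" by (simp add: restr_def)
  then show ?case by simp
next
  case (insert j S)
  let ?R = "\<lambda>S. restr (- (\<Union>j\<in>S. annulus j)) f"
  have R: "?R S \<in> D" if "finite S" for S
    using that by (intro subsetD[OF D] restr_mixed_Lebesgue[OF q _ f] borel_comp sets.finite_UN) auto
  have in_D: "restr (annulus j) f \<in> D" "?R S \<in> D" "?R (insert j S) \<in> D"
    by (rule subsetD[OF D restr_mixed_Lebesgue[OF q annulus_borel f]],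
        rule R, rule insert.hyps, rule R, rule finite.insertI, rule insert.hyps)
  have "annulus j \<inter> annulus i = {}" if "i \<in> S" for i
    using annulus_disjoint[of j i] insert.hyps(2) that by blast
  then have "- (\<Union>j\<in>S. annulus j) = annulus j \<union> - (\<Union>j\<in>insert j S. annulus j)"
    by blast
  then have "?R S = restr (annulus j \<union> - (\<Union>j\<in>insert j S. annulus j)) f"
    by (rule arg_cong)
  also have "\<dots> = (\<lambda>x. restr (annulus j) f x + ?R (insert j S) x)"
    by (rule restr_Un) blast
  finally have split: "?R S = (\<lambda>x. restr (annulus j) f x + ?R (insert j S) x)" .
  have "AE x in lebesgue. norm (T (?R S) x)
      \<le> norm (T (restr (annulus j) f) x) + norm (T (?R (insert j S)) x)"
    using T in_D(1,3) in_D(2)[unfolded split] unfolding sublinear_operator_def split by blast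
  with insert.IH show ?case
    by eventually_elim (use insert.hyps in auto)
qed

lemma eventually_in_finite_annuli:
  assumes "x \<noteq> 0"
  shows "\<forall>\<^sub>F N in sequentially. x \<in> (\<Union>j\<in>{- int N..int N}. annulus j)"
  using eventually_ge_at_top[of "nat \<bar>\<lceil>log 2 (norm x)\<rceil>\<bar>"]
proof eventually_elim
  case (elim N)
  then have "\<lceil>log 2 (norm x)\<rceil> \<in> {- int N..int N}" by auto
  then show ?case
    using assms by (auto simp: mem_annulus_iff_ceiling)
qed

text \<open>
  For \<open>f\<close> in the mixed Lebesgue space the annular decomposition follows from sublinearity
  and boundedness, since the truncations of \<open>f\<close> to finitely many annuli converge in norm.
\<close>

lemma mixed_norm_le_infsum_annuli:
  fixes q :: "real^'n::{finite,linorder}"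
    and T :: "(real^'n::{finite,linorder} \<Rightarrow> 'a::{real_normed_field,euclidean_space}) \<Rightarrow> (real^'n::{finite,linorder} \<Rightarrow> 'a)"
  assumes q: "\<And>i. 1 \<le> q $ i" and D: "mixed_Lebesgue q \<subseteq> D" and T: "sublinear_operator D T"
    and bounded: "\<And>f. f \<in> mixed_Lebesgue q \<Longrightarrow> mixed_norm q (T f) \<le> ennreal C * mixed_norm q f"
    and f: "f \<in> mixed_Lebesgue q"
  shows "mixed_norm q (restr (annulus k) (T f))
    \<le> (\<Sum>\<^sub>\<infinity>j\<in>UNIV. mixed_norm q (restr (annulus k) (T (restr (annulus j) f))))"
proof -
  let ?E = "\<lambda>N. - (\<Union>j\<in>{- int N..int N}. annulus j) :: (real^'n::{finite,linorder}) set"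
  let ?B = "\<lambda>j. mixed_norm q (restr (annulus k) (T (restr (annulus j) f)))"
  have q0: "0 < q $ i" for i using q[of i] by simp
  have TD: "T g \<in> borel_measurable lebesgue" if "g \<in> mixed_Lebesgue q" for g
    using T D that by (auto simp: sublinear_operator_def)
  have meas [measurable]: "(\<lambda>x. ennreal (norm (T (restr S f) x))) \<in> borel_measurable lebesgue"
    if "S \<in> sets borel" for S
    using TD[OF restr_mixed_Lebesgue[OF q that f]] by measurable
  have [measurable]: "indicator (annulus k) \<in> borel_measurable (lebesgue :: (real^'n::{finite,linorder}) measure)"
    by (intro borel_measurable_indicator borel_in_lebesgue annulus_borel)
  have le: "mixed_norm q (restr (annulus k) (T f))
      \<le> (\<Sum>\<^sub>\<infinity>j\<in>UNIV. ?B j) + ennreal C * mixed_norm q (restr (?E N) f)" for N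
  proof -
    let ?S = "{- int N..int N}"
    let ?F = "\<lambda>j x. indicator (annulus k) x * ennreal (norm (T (restr (annulus j) f) x))"
    have E [measurable]: "?E N \<in> sets borel" by auto
    \<comment> \<open>On the remainder the restriction to \<open>annulus k\<close> is dropped, since
      boundedness of \<open>T\<close> controls its full norm.\<close>
    have "mixed_norm q (restr (annulus k) (T f))
        \<le> total_norm q (\<lambda>x. (\<Sum>j\<in>?S. ?F j x) + ennreal (norm (T (restr (?E N) f) x)))"
      unfolding mixed_norm_restr[OF q]
    proof (rule total_norm_mono_AE[OF q])
      have "AE x in lebesgue. norm (T f x)
          \<le> (\<Sum>j\<in>?S. norm (T (restr (annulus j) f) x)) + norm (T (restr (?E N) f) x)"
        by (rule sublinear_annular_decomposition[OF q D T f]) simp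
      then show "AE x in lebesgue. indicator (annulus k) x * ennreal (norm (T f x))
          \<le> (\<Sum>j\<in>?S. ?F j x) + ennreal (norm (T (restr (?E N) f) x))"
      proof eventually_elim
        case (elim x)
        from ennreal_leI[OF elim] show ?case
          by (auto simp: indicator_def sum_nonneg sum_ennreal)
      qed
    qed
    also have "\<dots> \<le> total_norm q (\<lambda>x. \<Sum>j\<in>?S. ?F j x) + total_norm q (\<lambda>x. ennreal (norm (T (restr (?E N) f) x)))"
      using meas[OF E] by (intro total_norm_add[OF q] borel_measurable_sum) measurable
    also have "\<dots> \<le> (\<Sum>j\<in>?S. total_norm q (?F j)) + mixed_norm q (T (restr (?E N) f))"
      unfolding mixed_norm_eq_total_norm[OF q0]
      by (intro add_right_mono total_norm_sum[OF q]) auto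
    also have "\<dots> \<le> (\<Sum>\<^sub>\<infinity>j\<in>UNIV. ?B j) + ennreal C * mixed_norm q (restr (?E N) f)"
    proof (rule add_mono)
      show "(\<Sum>j\<in>?S. total_norm q (?F j)) \<le> (\<Sum>\<^sub>\<infinity>j\<in>UNIV. ?B j)"
        unfolding mixed_norm_restr[OF q] by (subst nonneg_infsum_complete) (auto intro!: SUP_upper)
      show "mixed_norm q (T (restr (?E N) f)) \<le> ennreal C * mixed_norm q (restr (?E N) f)"
        by (rule bounded[OF restr_mixed_Lebesgue[OF q E f]])
    qed
    finally show ?thesis .
  qed
  have "(\<lambda>N. mixed_norm q (restr (?E N) f)) \<longlonglongrightarrow> 0"
    unfolding mixed_norm_restr[OF q]
  proof (rule total_norm_truncate_tendsto_0[OF q])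
    show "(\<lambda>x. ennreal (norm (f x))) \<in> borel_measurable lebesgue"
        "total_norm q (\<lambda>x. ennreal (norm (f x))) < top"
      using f by (auto simp: mixed_Lebesgue_def mixed_norm_eq_total_norm[OF q0])
    \<comment> \<open>The annuli miss only the origin, which is a null set.\<close>
    have "AE x in lborel. x \<noteq> (0 :: real^'n::{finite,linorder})"
      by (rule AE_lborel_singleton)
    then show "AE x in lborel. \<forall>\<^sub>F N in sequentially. x \<notin> ?E N"
    proof eventually_elim
      case (elim x)
      from eventually_in_finite_annuli[OF this] show ?case by eventually_elim auto
    qed
  qed auto
  then have "(\<lambda>N. (\<Sum>\<^sub>\<infinity>j\<in>UNIV. ?B j) + ennreal C * mixed_norm q (restr (?E N) f)) \<longlonglongrightarrow> (\<Sum>\<^sub>\<infinity>j\<in>UNIV. ?B j) + ennreal C * 0"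
    by (intro tendsto_add tendsto_const ennreal_tendsto_cmult) auto
  from LIMSEQ_le_const[OF this] le show ?thesis by auto
qed

theorem theorem3p1:
  fixes \<alpha> l p :: real
    and q :: "real^'n::{finite,linorder}"
    and D :: "(real^'n::{finite,linorder} \<Rightarrow> 'a::{real_normed_field,euclidean_space}) set"
    and T :: "(real^'n::{finite,linorder} \<Rightarrow> 'a) \<Rightarrow> (real^'n::{finite,linorder} \<Rightarrow> 'a)"
  assumes "0 \<le> l" and "0 < p" and "\<And>i. 1 < q $ i"
    and "- (\<Sum>i\<in>UNIV. 1 / q $ i) + l < \<alpha>"
    and "\<alpha> < real CARD('n) * (1 - 1 / real CARD('n) * (\<Sum>i\<in>UNIV. 1 / q $ i))"
    and domain: "mixed_Lebesgue q \<subseteq> D" "\<And>k. L1_on_annulus k \<subseteq> D" "herz_morrey \<alpha> l p q \<subseteq> D"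
    and sublinear: "sublinear_operator D T"
    and annular_decomposition:
      "\<And>f. f \<in> herz_morrey \<alpha> l p q \<Longrightarrow> f \<notin> mixed_Lebesgue q \<Longrightarrow>
         AE x in lebesgue. ennreal (norm (T f x))
           \<le> (\<Sum>\<^sub>\<infinity>k\<in>(UNIV :: int set). ennreal (norm (T (restr (annulus k) f) x)))"
    and bounded_Lq: "bounded_operator_on (mixed_Lebesgue q) (mixed_norm q) T"
    and size_outer: "\<exists>C::real. \<forall>k. \<forall>f\<in>L1_on_annulus k. AE x in lebesgue.
      norm x \<ge> 2 powi (k + 1) \<longrightarrow>
      norm (T f x) \<le> C * (\<integral>y. norm (f y) \<partial>lebesgue) * norm x powi (- int CARD('n))"
    and size_inner: "\<exists>C::real. \<forall>k. \<forall>f\<in>L1_on_annulus k. AE x in lebesgue.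
      norm x \<le> 2 powi (k - 2) \<longrightarrow>
      norm (T f x) \<le> C * (\<integral>y. norm (f y) \<partial>lebesgue) * 2 powi (- int CARD('n) * k)"
  shows "bounded_operator_on (herz_morrey \<alpha> l p q) (herz_morrey_norm \<alpha> l p q) T"
proof -
  define n where "n = real CARD('n)"
  define s where "s = (\<Sum>i\<in>UNIV. 1 / q $ i)"
  define \<epsilon> where "\<epsilon> = min (n - s - \<alpha>) (s + \<alpha> - l)"
  \<comment> \<open>Exponent of the kernel at distance m = k - j, in the form that
    \<open>herz_seq_convolution_le\<close> expects.\<close>
  define w where "w m = of_int m * (l - \<alpha>) - \<epsilon> * \<bar>of_int m\<bar>" for m :: int
  have q: "1 \<le> q $ i" for i
    using assms(3)[of i] by simp
  have "n * (1 - 1 / n * s) = n - s"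
    by (simp add: n_def field_simps)
  then have \<epsilon>: "0 < \<epsilon>" "\<epsilon> \<le> n - s - \<alpha>" "\<epsilon> \<le> s + \<alpha> - l"
    using assms(4,5) by (auto simp: \<epsilon>_def n_def s_def)
  have "0 \<le> n" by (simp add: n_def)

  obtain Cq where Cq: "\<And>f. f \<in> mixed_Lebesgue q \<Longrightarrow> T f \<in> mixed_Lebesgue q"
      "\<And>f. f \<in> mixed_Lebesgue q \<Longrightarrow> mixed_norm q (T f) \<le> ennreal Cq * mixed_norm q f"
    using bounded_Lq unfolding bounded_operator_on_def by blast
  obtain C1 where C1: "\<And>k f. f \<in> L1_on_annulus k \<Longrightarrow> AE x in lebesgue. norm x \<ge> 2 powi (k + 1) \<longrightarrow>
      norm (T f x) \<le> C1 * (\<integral>y. norm (f y) \<partial>lebesgue) * norm x powi (- int CARD('n))"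
    using size_outer by blast
  obtain C2 where C2: "\<And>k f. f \<in> L1_on_annulus k \<Longrightarrow> AE x in lebesgue. norm x \<le> 2 powi (k - 2) \<longrightarrow>
      norm (T f x) \<le> C2 * (\<integral>y. norm (f y) \<partial>lebesgue) * 2 powi (- int CARD('n) * k)"
    using size_inner by blast

  \<comment> \<open>Large enough for all three ranges of j: 2n is the loss in the outer estimate and
    exceeds the loss n of the inner one, and the other two terms bound - \<open>w m\<close> from
    above for |m| \<le> 1.\<close>
  define B where "B = 2 * n + \<bar>l - \<alpha>\<bar> + \<epsilon>"
  define C where "C = (\<bar>C1\<bar> + \<bar>C2\<bar> + \<bar>Cq\<bar>) * 2 powr B"
  have "0 \<le> C" by (simp add: C_def)
  have C_le: "ennreal c * (pow2 e * t) \<le> ennreal C * (pow2 (w m) * t)"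
    if "c \<le> \<bar>C1\<bar> + \<bar>C2\<bar> + \<bar>Cq\<bar>" "e \<le> B + w m" for c e t m
  proof -
    have "ennreal c * (pow2 e * t) \<le> ennreal (\<bar>C1\<bar> + \<bar>C2\<bar> + \<bar>Cq\<bar>) * (pow2 (B + w m) * t)"
      using that by (intro mult_mono mult_right_mono ennreal_leI pow2_mono) auto
    also have "\<dots> = ennreal C * (pow2 (w m) * t)"
      unfolding pow2_add C_def by (simp add: pow2_def ennreal_mult' mult_ac)
    finally show ?thesis .
  qed

  have piece: "mixed_norm q (restr (annulus k) (T (restr (annulus j) f)))
      \<le> ennreal C * (pow2 (w (k - j)) * mixed_norm q (restr (annulus j) f))"
    if f: "restr (annulus j) f \<in> mixed_Lebesgue q" for f j k
  proof -
    let ?f = "restr (annulus j) f"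
    note L1 = restr_annulus_L1(1)[OF q f]
    have I: "0 \<le> (\<integral>y. norm (?f y) \<partial>lebesgue)" by simp
    consider "j + 2 \<le> k" | "k + 2 \<le> j" | "\<bar>k - j\<bar> \<le> 1" by linarith
    then show ?thesis
    proof cases
      case 1
      have "mixed_norm q (restr (annulus k) (T ?f))
          \<le> ennreal \<bar>C1\<bar> * (pow2 (of_int (j - k) * (n - s) + 2 * n) * mixed_norm q ?f)"
        unfolding n_def s_def
      proof (rule mixed_norm_outer_annulus_le[OF q abs_ge_zero f _ 1])
        \<comment> \<open>The size hypothesis may provide a negative constant; its absolute value is
          admissible because the integral of the norm is nonnegative.\<close>
        show "AE x in lebesgue. norm x \<ge> 2 powi (j + 1) \<longrightarrow>
            norm (T ?f x) \<le> \<bar>C1\<bar> * (\<integral>y. norm (?f y) \<partial>lebesgue) * norm x powi (- int CARD('n))"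
          using C1[OF L1]
        proof eventually_elim
          case (elim x)
          have "C1 * (\<integral>y. norm (?f y) \<partial>lebesgue) * norm x powi (- int CARD('n))
              \<le> \<bar>C1\<bar> * (\<integral>y. norm (?f y) \<partial>lebesgue) * norm x powi (- int CARD('n))"
            using I by (intro mult_right_mono) auto
          with elim show ?case by linarith
        qed
      qed
      also have "\<dots> \<le> ennreal C * (pow2 (w (k - j)) * mixed_norm q ?f)"
      proof (rule C_le)
        \<comment> \<open>For m = k - j > 0 the claim amounts to \<epsilon> \<le> n - s - \<alpha> +
          l, which follows from the first gap and l \<ge> 0.\<close>
        have "of_int (k - j) * \<epsilon> \<le> of_int (k - j) * (n - s - \<alpha>)" "0 \<le> of_int (k - j) * l"
          using 1 \<epsilon> \<open>0 \<le> l\<close> by (intro mult_left_mono mult_nonneg_nonneg; simp)+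
        then show "of_int (j - k) * (n - s) + 2 * n \<le> B + w (k - j)"
          using 1 \<epsilon> by (simp add: B_def w_def algebra_simps)
      qed simp
      finally show ?thesis .
    next
      case 2
      have "mixed_norm q (restr (annulus k) (T ?f))
          \<le> ennreal \<bar>C2\<bar> * (pow2 (of_int (k - j) * s + n) * mixed_norm q ?f)"
        unfolding n_def s_def
      proof (rule mixed_norm_inner_annulus_le[OF q abs_ge_zero f _ 2])
        show "AE x in lebesgue. norm x \<le> 2 powi (j - 2) \<longrightarrow>
            norm (T ?f x) \<le> \<bar>C2\<bar> * (\<integral>y. norm (?f y) \<partial>lebesgue) * 2 powi (- int CARD('n) * j)"
          using C2[OF L1]
        proof eventually_elim
          case (elim x)
          have "C2 * (\<integral>y. norm (?f y) \<partial>lebesgue) * 2 powi (- int CARD('n) * j)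
              \<le> \<bar>C2\<bar> * (\<integral>y. norm (?f y) \<partial>lebesgue) * 2 powi (- int CARD('n) * j)"
            using I by (intro mult_right_mono) auto
          with elim show ?case by linarith
        qed
      qed
      also have "\<dots> \<le> ennreal C * (pow2 (w (k - j)) * mixed_norm q ?f)"
      proof (rule C_le)
        \<comment> \<open>For k < j the gap that matters is s + \<alpha> - l, with the sign of k - j
          reversed.\<close>
        have "of_int (j - k) * \<epsilon> \<le> of_int (j - k) * (s + \<alpha> - l)"
          using 2 \<epsilon> by (intro mult_left_mono) auto
        then show "of_int (k - j) * s + n \<le> B + w (k - j)"
          using 2 \<epsilon> \<open>0 \<le> n\<close> by (simp add: B_def w_def algebra_simps)
      qed simp
      finally show ?thesis .
    next
      case 3
      have "mixed_norm q (restr (annulus k) (T ?f)) \<le> mixed_norm q (T ?f)"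
        by (rule mixed_norm_restr_le[OF q])
      also have "\<dots> \<le> ennreal Cq * (pow2 0 * mixed_norm q ?f)"
        using Cq(2)[OF f] by simp
      also have "\<dots> \<le> ennreal C * (pow2 (w (k - j)) * mixed_norm q ?f)"
      proof (rule C_le)
        have m: "\<bar>of_int (k - j) :: real\<bar> \<le> 1"
          using 3 by (simp only: of_int_abs[symmetric])
        have "- (of_int (k - j) * (l - \<alpha>)) \<le> \<bar>of_int (k - j)\<bar> * \<bar>l - \<alpha>\<bar>"
          by (metis abs_ge_minus_self abs_mult)
        also have "\<dots> \<le> \<bar>l - \<alpha>\<bar>"
          using mult_right_mono[OF m, of "\<bar>l - \<alpha>\<bar>"] by simp
        finally have "- (of_int (k - j) * (l - \<alpha>)) \<le> \<bar>l - \<alpha>\<bar>" .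
        moreover have "\<epsilon> * \<bar>of_int (k - j)\<bar> \<le> \<epsilon> * 1"
          using m \<epsilon>(1) by (intro mult_left_mono) auto
        ultimately show "0 \<le> B + w (k - j)"
          using \<open>0 \<le> n\<close> unfolding B_def w_def by linarith
      qed simp
      finally show ?thesis .
    qed
  qed

  obtain C' where C': "0 \<le> C'"
    "\<And>a b. (\<And>k. b k \<le> (\<Sum>\<^sub>\<infinity>j\<in>UNIV. ennreal C * (pow2 (w (k - j)) * a j)))
      \<Longrightarrow> herz_seq \<alpha> l p b \<le> ennreal C' * herz_seq \<alpha> l p a"
    unfolding w_def
    by (rule herz_seq_convolution_le[OF \<epsilon>(1) \<open>0 < p\<close> \<open>0 \<le> C\<close>, where l=l and \<alpha>=\<alpha>]) blast

  have "T f \<in> herz_morrey \<alpha> l p q \<and> herz_morrey_norm \<alpha> l p q (T f) \<le> ennreal C' * herz_morrey_norm \<alpha> l p q f"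
    if f: "f \<in> herz_morrey \<alpha> l p q" for f
  proof -
    let ?b = "\<lambda>k. mixed_norm q (restr (annulus k) (T f))"
    have loc: "restr (annulus j) f \<in> mixed_Lebesgue q" for j
      using f by (auto simp: herz_morrey_def intro: restr_annulus_mixed_Lebesgue[OF q])
    have Tf: "T f \<in> borel_measurable lebesgue"
      using f domain(3) sublinear by (auto simp: sublinear_operator_def)
    \<comment> \<open>Inside the mixed Lebesgue space the decomposition comes from norm limits;
      outside it, from the assumed pointwise bound and the countable Minkowski inequality.\<close>
    have "?b k \<le> (\<Sum>\<^sub>\<infinity>j\<in>UNIV. mixed_norm q (restr (annulus k) (T (restr (annulus j) f))))" for k
    proof (cases "f \<in> mixed_Lebesgue q")
      case True
      show ?thesis
        by (rule mixed_norm_le_infsum_annuli[OF q domain(1) sublinear _ True]) (rule Cq(2))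
    next
      case False
      let ?F = "\<lambda>j x. indicator (annulus k) x * ennreal (norm (T (restr (annulus j) f) x))"
      have "?b k \<le> total_norm q (\<lambda>x. \<Sum>\<^sub>\<infinity>j\<in>UNIV. ?F j x)"
        unfolding mixed_norm_restr[OF q]
      proof (rule total_norm_mono_AE[OF q])
        show "AE x in lebesgue. indicator (annulus k) x * ennreal (norm (T f x)) \<le> (\<Sum>\<^sub>\<infinity>j\<in>UNIV. ?F j x)"
          using annular_decomposition[OF f False]
          by eventually_elim (auto simp: indicator_def)
      qed
      also have "\<dots> \<le> (\<Sum>\<^sub>\<infinity>j\<in>UNIV. total_norm q (?F j))"
      proof (rule total_norm_infsum[OF q])
        fix j
        have [measurable]: "T (restr (annulus j) f) \<in> borel_measurable lebesgue"
          using Cq(1)[OF loc[of j]] by (simp add: mixed_Lebesgue_def)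
        have [measurable]: "indicator (annulus k) \<in> borel_measurable (lebesgue :: (real^'n::{finite,linorder}) measure)"
          by (intro borel_measurable_indicator borel_in_lebesgue annulus_borel)
        show "?F j \<in> borel_measurable lebesgue"
          by measurable
      qed
      finally show ?thesis
        unfolding mixed_norm_restr[OF q] .
    qed
    also have "(\<Sum>\<^sub>\<infinity>j\<in>UNIV. mixed_norm q (restr (annulus k) (T (restr (annulus j) f))))
        \<le> (\<Sum>\<^sub>\<infinity>j\<in>UNIV. ennreal C * (pow2 (w (k - j)) * mixed_norm q (restr (annulus j) f)))" for k
      unfolding infsum_ennreal_eq_nn_integral by (intro nn_integral_mono piece loc)
    finally have le: "herz_morrey_norm \<alpha> l p q (T f) \<le> ennreal C' * herz_morrey_norm \<alpha> l p q f"
      unfolding herz_morrey_norm_eq_herz_seq by (rule C'(2))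
    have "herz_morrey_norm \<alpha> l p q f < top"
      using f by (simp add: herz_morrey_def)
    with le have fin: "herz_morrey_norm \<alpha> l p q (T f) < top"
      by (auto intro: le_less_trans simp: ennreal_mult_less_top)
    \<comment> \<open>A finite Herz-Morrey norm makes every annular norm finite, and
      \<open>K\<close> is covered by finitely many annuli.\<close>
    have "restr K (T f) \<in> mixed_Lebesgue q" if K: "compact K" "K \<subseteq> UNIV - {0}" for K
    proof -
      obtain S where S: "finite S" "K \<subseteq> (\<Union>k\<in>S. annulus k)"
        using compact_subset_finite_annuli[OF K] .
      have "mixed_norm q (restr K (T f)) \<le> (\<Sum>k\<in>S. ?b k)"
        by (rule mixed_norm_restr_UN_le[OF q S Tf])
      also have "\<dots> < top"
        using herz_seq_finite_imp[OF \<open>0 < p\<close> fin[unfolded herz_morrey_norm_eq_herz_seq]] S(1) by simp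
      finally show ?thesis
        using K Tf by (auto simp: mixed_Lebesgue_def intro!: restr_borel_measurable borel_in_lebesgue borel_compact)
    qed
    then have "T f \<in> mixed_Lebesgue_loc q"
      using Tf by (auto simp: mixed_Lebesgue_loc_def)
    with fin le show ?thesis
      by (simp add: herz_morrey_def)
  qed
  then show ?thesis
    unfolding bounded_operator_on_def by blast
qed

end
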